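(* Let $f(\cdot;i):\mathbb{R}^d\to\mathbb{R}$, $i\in[n]$, be convex and $L$-smooth with a common constant $L>0$, let $F=\frac1n\sum_{i=1}^n f(\cdot;i)$ have a nonempty set of minimizers, let $w_*$ be a minimizer of $F$, and let $\sigma^2:=\frac1n\sum_{i=1}^n\|\nabla f(w_*;i)\|^2$. Run the SMG algorithm for $T\ge 1$ epochs with a fixed momentum parameter $0\le\beta<1$, epoch learning rates $\eta_t$ (inner step sizes $\eta_i^{(t)}=\eta_t/n$) and the randomized reshuffling strategy. Assume that for some $\alpha>0$ we have $\eta_t\le\alpha\eta_{t-1}$ for $t\ge2$, and that $0<\eta_t\le\frac{1}{2L\sqrt K}$ for $t\ge1$, where $K:=1+\alpha\beta$. Then the output $\hat w_T$ satisfies $$\mathbb{E}\left[F(\hat w_T)-F(w_* )\right]\le\frac{\mathbb{E}\left[\|\tilde w_0-w_*\|^2\right]}{2(1-\beta)\sum_{t=1}^T\eta_t}+\frac{4L\sigma^2(1+\alpha\beta)}{6n(1-\beta)}\,\frac{\sum_{t=1}^T\eta_t^3}{\sum_{t=1}^T\eta_t}.$$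
   Context: $[n]:=\{1,\dots,n\}$. $L$-smooth means $\|\nabla f(w;i)-\nabla f(w';i)\|\le L\|w-w'\|$ for all $w,w'\in\mathbb{R}^d$ and all $i\in[n]$. SMG (Shuffling Momentum Gradient) algorithm: choose $\tilde w_0\in\mathbb{R}^d$ and set $\tilde m_0:=\mathbf 0$. For $t=1,\dots,T$: set $w_0^{(t)}:=\tilde w_{t-1}$, $m_0^{(t)}:=\tilde m_{t-1}$, $v_0^{(t)}:=\mathbf 0$; generate a permutation $\pi^{(t)}$ of $[n]$; for $i=0,\dots,n-1$ set $g_i^{(t)}:=\nabla f(w_i^{(t)};\pi^{(t)}(i+1))$, $m_{i+1}^{(t)}:=\beta m_0^{(t)}+(1-\beta)g_i^{(t)}$, $v_{i+1}^{(t)}:=v_i^{(t)}+\frac1n g_i^{(t)}$, $w_{i+1}^{(t)}:=w_i^{(t)}-\frac{\eta_t}{n}m_{i+1}^{(t)}$; then set $\tilde w_t:=w_n^{(t)}$, $\tilde m_t:=v_n^{(t)}$. Output: $\hat w_T\in\{\tilde w_0,\dots,\tilde w_{T-1}\}$ is chosen at random with probability $\mathbb{P}[\hat w_T=\tilde w_{t-1}]=\eta_t/\sum_{s=1}^T\eta_s$ for $t=1,\dots,T$. Randomized reshuffling: at each epoch $t$, $\pi^{(t)}$ is drawn uniformly at random from all permutations of $[n]$, independently of the previous epochs. $\mathbb{E}$ is the total expectation. *)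

theory Defs
  imports "HOL-Probability.Probability"
begin

section \<open>Objective functions\<close>

definition gradient :: "('a::euclidean_space \<Rightarrow> real) \<Rightarrow> 'a \<Rightarrow> 'a" where
  "gradient f w = (THE D. GDERIV f w :> D)"

text \<open>Differentiability is part of the definition, so that \<^const>\<open>gradient\<close> is meaningful.\<close>

definition L_smooth :: "real \<Rightarrow> ('a::euclidean_space \<Rightarrow> real) \<Rightarrow> bool" where
  "L_smooth L f \<longleftrightarrow>
     (\<forall>w. f differentiable (at w)) \<and>
     (\<forall>w w'. norm (gradient f w - gradient f w') \<le> L * norm (w - w'))"

definition finite_sum_objective :: "nat \<Rightarrow> (nat \<Rightarrow> 'a \<Rightarrow> real) \<Rightarrow> 'a \<Rightarrow> real" where
  "finite_sum_objective n f w = (1 / real n) * (\<Sum>i=1..n. f i w)"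


section \<open>The shuffling momentum gradient algorithm\<close>

text \<open>The triple \<open>(w, m, v)\<close> after \<open>i\<close> inner steps of one epoch with epoch learning rate \<open>h\<close>,
  permutation \<open>p\<close> of \<open>{1..n}\<close>, and start values \<open>w0\<close> and \<open>m0\<close>.\<close>

primrec smg_inner :: "nat \<Rightarrow> (nat \<Rightarrow> 'a::euclidean_space \<Rightarrow> real) \<Rightarrow> real \<Rightarrow> real \<Rightarrow> (nat \<Rightarrow> nat)
    \<Rightarrow> 'a \<Rightarrow> 'a \<Rightarrow> nat \<Rightarrow> 'a \<times> 'a \<times> 'a" where
  "smg_inner n f \<beta> h p w0 m0 0 = (w0, m0, 0)"
| "smg_inner n f \<beta> h p w0 m0 (Suc i) =
     (case smg_inner n f \<beta> h p w0 m0 i of (w, m, v) \<Rightarrow>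
        let g = gradient (f (p (i + 1))) w;
            m' = \<beta> *\<^sub>R m0 + (1 - \<beta>) *\<^sub>R g;
            v' = v + (1 / real n) *\<^sub>R g;
            w' = w - (h / real n) *\<^sub>R m'
        in (w', m', v'))"

text \<open>The pair of epoch iterate and epoch momentum after \<open>t\<close> epochs; \<open>\<eta> t\<close> and \<open>\<pi> t\<close> are used in
  epoch \<open>t\<close>, where epochs are counted from 1.\<close>

primrec smg_epoch :: "nat \<Rightarrow> (nat \<Rightarrow> 'a::euclidean_space \<Rightarrow> real) \<Rightarrow> real \<Rightarrow> (nat \<Rightarrow> real)
    \<Rightarrow> (nat \<Rightarrow> nat \<Rightarrow> nat) \<Rightarrow> 'a \<Rightarrow> nat \<Rightarrow> 'a \<times> 'a" where
  "smg_epoch n f \<beta> \<eta> \<pi> w0 0 = (w0, 0)"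
| "smg_epoch n f \<beta> \<eta> \<pi> w0 (Suc t) =
     (case smg_epoch n f \<beta> \<eta> \<pi> w0 t of (w, m) \<Rightarrow>
        (case smg_inner n f \<beta> (\<eta> (Suc t)) (\<pi> (Suc t)) w m n of (w', m', v') \<Rightarrow> (w', v')))"

definition smg_iterate :: "nat \<Rightarrow> (nat \<Rightarrow> 'a::euclidean_space \<Rightarrow> real) \<Rightarrow> real \<Rightarrow> (nat \<Rightarrow> real)
    \<Rightarrow> (nat \<Rightarrow> nat \<Rightarrow> nat) \<Rightarrow> 'a \<Rightarrow> nat \<Rightarrow> 'a" where
  "smg_iterate n f \<beta> \<eta> \<pi> w0 t = fst (smg_epoch n f \<beta> \<eta> \<pi> w0 t)"


section \<open>Sources of randomness\<close>

definition perm_space :: "nat \<Rightarrow> (nat \<Rightarrow> nat) measure" where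
  "perm_space n = count_space {p. p permutes {1..n}}"

abbreviation perms_space :: "nat \<Rightarrow> nat \<Rightarrow> (nat \<Rightarrow> nat \<Rightarrow> nat) measure" where
  "perms_space n T \<equiv> PiM {1..T} (\<lambda>_. perm_space n)"

text \<open>The library's \<open>prob_space.indep_var\<close> requires both variables to take values in the same type;
  this is the same notion, independence of the generated sigma-algebras, without that restriction.\<close>

definition indep_rv :: "'b measure \<Rightarrow> 'c measure \<Rightarrow> ('b \<Rightarrow> 'c) \<Rightarrow> 'd measure \<Rightarrow> ('b \<Rightarrow> 'd) \<Rightarrow> bool" where
  "indep_rv M N X N' Y \<longleftrightarrow>
     X \<in> measurable M N \<and> Y \<in> measurable M N' \<and>
     prob_space.indep_set M {X -` A \<inter> space M | A. A \<in> sets N} {Y -` B \<inter> space M | B. B \<in> sets N'}"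

text \<open>The permutations of epochs \<open>1, \<dots>, T\<close> are uniform, mutually independent and independent of
  the (possibly random) initial point.\<close>

definition randomized_reshuffling ::
  "'b measure \<Rightarrow> nat \<Rightarrow> nat \<Rightarrow> ('b \<Rightarrow> 'a::euclidean_space) \<Rightarrow> (nat \<Rightarrow> 'b \<Rightarrow> nat \<Rightarrow> nat) \<Rightarrow> bool" where
  "randomized_reshuffling M n T W0 \<pi> \<longleftrightarrow>
     (\<forall>t\<in>{1..T}. distr M (perm_space n) (\<pi> t) = uniform_count_measure {p. p permutes {1..n}}) \<and>
     prob_space.indep_vars M (\<lambda>_. perm_space n) \<pi> {1..T} \<and>
     indep_rv M borel W0 (perms_space n T) (\<lambda>\<omega>. \<lambda>t\<in>{1..T}. \<pi> t \<omega>)"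

text \<open>\<open>\<tau>\<close> is the random epoch whose initial iterate is returned; it is drawn independently of the
  run of the algorithm.\<close>

definition random_output_epoch ::
  "'b measure \<Rightarrow> nat \<Rightarrow> nat \<Rightarrow> (nat \<Rightarrow> real) \<Rightarrow> ('b \<Rightarrow> 'a::euclidean_space)
    \<Rightarrow> (nat \<Rightarrow> 'b \<Rightarrow> nat \<Rightarrow> nat) \<Rightarrow> ('b \<Rightarrow> nat) \<Rightarrow> bool" where
  "random_output_epoch M n T \<eta> W0 \<pi> \<tau> \<longleftrightarrow>
     indep_rv M
       (borel \<Otimes>\<^sub>M perms_space n T) (\<lambda>\<omega>. (W0 \<omega>, \<lambda>t\<in>{1..T}. \<pi> t \<omega>))
       (count_space {1..T}) \<tau> \<and>
     (\<forall>t\<in>{1..T}. measure M {\<omega> \<in> space M. \<tau> \<omega> = t} = \<eta> t / (\<Sum>s=1..T. \<eta> s))"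

end

theory Submission
  imports Defs
begin

text \<open>
  \<^bold>\<open>Pathwise descent.\<close> Fix the starting point and all permutations. Since every inner step of an epoch
  uses the same \<open>m\<^sub>0\<close>, an epoch with learning rate \<open>\<eta>\<^sub>t\<close> acts as
  \<open>w\<^sub>t = w\<^sub>t\<^sub>-\<^sub>1 - \<eta>\<^sub>t (\<beta> m\<^sub>t\<^sub>-\<^sub>1 + (1 - \<beta>) m\<^sub>t)\<close>, where \<open>m\<^sub>t\<close> is the average of the component gradients met in
  epoch \<open>t\<close> and \<open>m\<^sub>0 = 0\<close>. Expanding \<open>\<parallel>w\<^sub>t - w\<^sub>*\<parallel>\<^sup>2\<close> leaves the products of \<open>m\<^sub>t\<close> and of \<open>m\<^sub>t\<^sub>-\<^sub>1\<close> with
  \<open>w\<^sub>t\<^sub>-\<^sub>1 - w\<^sub>*\<close>. The point \<open>w\<^sub>t\<^sub>-\<^sub>1\<close> is the start of epoch \<open>t\<close> and the end of epoch \<open>t - 1\<close>, so both products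
  pair the average gradient of an epoch with an endpoint of the same epoch. Writing such a product with Bregman
  distances \<open>B\<^sub>i\<close> of the components, with \<open>z\<close> the endpoint,
  \<open>\<langle>\<nabla>f\<^sub>i(w), z - w\<^sub>*\<rangle> = f\<^sub>i(z) - f\<^sub>i(w\<^sub>*) + B\<^sub>i(w\<^sub>*, w) - B\<^sub>i(z, w)\<close>,
  gives the optimality gap at \<open>z\<close>, a gain that is at least \<open>G\<^sub>t / (2L)\<close> by co-coercivity, where \<open>G\<^sub>t\<close> is the mean
  squared distance of the gradients from their values at \<open>w\<^sub>*\<close>, and a loss that is at most \<open>L / 2\<close> times the mean
  squared distance of the inner iterates from \<open>z\<close> (lemmas \<open>inner_m_ge\<close>, \<open>inner_m_start_ge\<close>, \<open>inner_m_end_ge\<close>).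

  \<^bold>\<open>Paying for the losses.\<close> The inner iterates drift from the endpoints because of \<open>m\<^sub>t\<^sub>-\<^sub>1\<close>, because of the
  gradient deviations, and because of the partial sums of the gradients at \<open>w\<^sub>*\<close>. The first two are multiples of
  \<open>G\<^sub>t\<^sub>-\<^sub>1\<close> and \<open>G\<^sub>t\<close> (since \<open>\<parallel>m\<^sub>t\<parallel>\<^sup>2 \<le> G\<^sub>t\<close>, the gradients at \<open>w\<^sub>*\<close> summing to zero), and under
  \<open>\<eta>\<^sub>t \<le> 1 / (2 L \<surd>K)\<close> the gains absorb them. An epoch is felt once more in the next one through the stale
  momentum; that delayed loss is booked in a potential, and \<open>\<eta>\<^sub>t\<^sub>+\<^sub>1 \<le> \<alpha> \<eta>\<^sub>t\<close> bounds it (lemma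
  \<open>potential_decrease\<close>). Telescoping yields \<open>weighted_gaps_le\<close>, a deterministic inequality whose only remaining
  error is the sum of \<open>4 K L \<eta>\<^sub>t\<^sup>3 S(\<pi>\<^sub>t)\<close>, where \<open>S\<close> is the normalised energy of the partial sums of the gradients
  at \<open>w\<^sub>*\<close> in the order given by the permutation.

  \<^bold>\<open>Randomness.\<close> The error of epoch \<open>t\<close> depends on the permutation \<open>\<pi>\<^sub>t\<close> alone and not on the iterates. A sum of \<open>k\<close>
  vectors drawn without replacement from a family with zero sum has the variance of sampling with replacement
  reduced by the factor \<open>(n - k) / (n - 1)\<close>, so that \<open>S\<close> has expectation at most \<open>\<sigma>\<^sup>2 / (3 n)\<close> (lemma
  \<open>average_prefix_energy_le\<close>). Finally, the output epoch is independent of the run, so the expected gap at the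
  output is the average of the expected gaps with weights \<open>\<eta>\<^sub>t / \<Sum>\<eta>\<^sub>s\<close>.
\<close>

section \<open>Gradients of smooth convex functions\<close>

text \<open>
  \<^const>\<open>gradient\<close> is a definite description, so it says something only once a vector with the gradient
  property exists and is unique. Existence is the Riesz representation of the derivative in the standard basis.
\<close>

lemma gradient_GDERIV:
  assumes "f differentiable (at w)"
  shows "GDERIV f w :> gradient f w"
proof -
  obtain f' where f': "(f has_derivative f') (at w)"
    using assms by (auto simp: differentiable_def)
  interpret bounded_linear f' using f' by (rule has_derivative_bounded_linear)
  define D where "D = (\<Sum>b\<in>Basis. f' b *\<^sub>R b)"
  have "f' = (\<lambda>h. h \<bullet> D)"
  proof
    fix h
    have "f' h = f' (\<Sum>b\<in>Basis. (h \<bullet> b) *\<^sub>R b)" by (simp add: euclidean_representation)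
    also have "\<dots> = h \<bullet> D"
      by (simp add: sum scaleR D_def inner_sum_right mult.commute)
    finally show "f' h = h \<bullet> D" .
  qed
  then have D: "GDERIV f w :> D"
    using f' by (simp add: gderiv_def)
  have "E = D" if "GDERIV f w :> E" for E
  proof -
    have "(\<lambda>h. h \<bullet> E) = (\<lambda>h. h \<bullet> D)"
      using that D unfolding gderiv_def by (rule has_derivative_unique)
    then have "\<forall>h. h \<bullet> E = h \<bullet> D" by meson
    then show ?thesis by (simp only: vector_eq_ldot)
  qed
  with D show ?thesis
    unfolding gradient_def by (rule theI)
qed

lemma GDERIV_along_line:
  assumes "GDERIV f (y + t *\<^sub>R d) :> g"
  shows "((\<lambda>s. f (y + s *\<^sub>R d)) has_real_derivative g \<bullet> d) (at t)"
proof -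
  have "((\<lambda>s. y + s *\<^sub>R d) has_derivative (\<lambda>s. s *\<^sub>R d)) (at t)"
    by (auto intro!: derivative_eq_intros)
  from has_derivative_compose[OF this assms[unfolded gderiv_def]] show ?thesis
    by (simp add: has_field_derivative_def inner_commute mult_commute_abs)
qed

definition bregman :: "('a::euclidean_space \<Rightarrow> real) \<Rightarrow> 'a \<Rightarrow> 'a \<Rightarrow> real" where
  "bregman f x y = f x - f y - gradient f y \<bullet> (x - y)"

text \<open>
  Along the segment from \<open>y\<close> to \<open>x\<close> the function is convex in one real variable and lies above its tangent.
\<close>

lemma bregman_nonneg:
  assumes "convex_on UNIV f" and "f differentiable (at y)"
  shows "0 \<le> bregman f x y"
proof -
  define \<phi> where "\<phi> s = f (y + s *\<^sub>R (x - y))" for s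
  have "convex_on UNIV \<phi>"
  proof (rule convex_onI)
    fix t a b :: real assume "0 < t" "t < 1"
    then have "f ((1 - t) *\<^sub>R (y + a *\<^sub>R (x - y)) + t *\<^sub>R (y + b *\<^sub>R (x - y)))
        \<le> (1 - t) * \<phi> a + t * \<phi> b"
      unfolding \<phi>_def by (intro convex_onD[OF assms(1)]) auto
    moreover have "(1 - t) *\<^sub>R (y + a *\<^sub>R (x - y)) + t *\<^sub>R (y + b *\<^sub>R (x - y))
        = y + ((1 - t) * a + t * b) *\<^sub>R (x - y)"
      by (simp add: algebra_simps)
    ultimately show "\<phi> ((1 - t) *\<^sub>R a + t *\<^sub>R b) \<le> (1 - t) * \<phi> a + t * \<phi> b"
      by (simp add: \<phi>_def)
  qed simp
  moreover have "(\<phi> has_real_derivative gradient f y \<bullet> (x - y)) (at 0)"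
    unfolding \<phi>_def by (rule GDERIV_along_line) (use gradient_GDERIV[OF assms(2)] in simp)
  ultimately have "\<phi> 1 - \<phi> 0 \<ge> (gradient f y \<bullet> (x - y)) * (1 - 0)"
    by (intro convex_on_imp_above_tangent[where A = UNIV]) auto
  then show ?thesis by (simp add: \<phi>_def bregman_def)
qed

text \<open>
  The descent lemma. Subtracting the tangent and the parabola \<open>L/2 s\<^sup>2 \<parallel>x - y\<parallel>\<^sup>2\<close> from the function along the
  segment leaves a function of \<open>s\<close> that does not increase, by the Lipschitz bound on the gradient.
\<close>

lemma bregman_le_of_L_smooth:
  assumes "L_smooth L f"
  shows "bregman f x y \<le> L / 2 * (norm (x - y))\<^sup>2"
proof -
  define d where "d = x - y"
  define \<psi> where "\<psi> s = f (y + s *\<^sub>R d) - s * (gradient f y \<bullet> d) - L / 2 * s\<^sup>2 * (norm d)\<^sup>2" for s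
  have "\<psi> 1 \<le> \<psi> 0"
  proof (rule DERIV_nonpos_imp_nonincreasing[of 0 1 \<psi>])
    fix s :: real assume s: "0 \<le> s" "s \<le> 1"
    let ?g = "gradient f (y + s *\<^sub>R d)"
    have "GDERIV f (y + s *\<^sub>R d) :> ?g"
      using assms by (intro gradient_GDERIV) (simp add: L_smooth_def)
    from GDERIV_along_line[OF this]
    have "(\<psi> has_real_derivative (?g \<bullet> d - gradient f y \<bullet> d - L * s * (norm d)\<^sup>2)) (at s)"
      unfolding \<psi>_def by (auto intro!: derivative_eq_intros)
    moreover have "?g \<bullet> d - gradient f y \<bullet> d - L * s * (norm d)\<^sup>2 \<le> 0"
    proof -
      have "?g \<bullet> d - gradient f y \<bullet> d = (?g - gradient f y) \<bullet> d"
        by (simp add: inner_diff_left)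
      also have "\<dots> \<le> norm (?g - gradient f y) * norm d" by (rule norm_cauchy_schwarz)
      also have "\<dots> \<le> (L * norm (y + s *\<^sub>R d - y)) * norm d"
        using assms by (intro mult_right_mono) (auto simp only: L_smooth_def norm_ge_zero)
      also have "\<dots> = L * s * (norm d)\<^sup>2" using s by (simp add: power2_eq_square)
      finally show ?thesis by simp
    qed
    ultimately show "\<exists>D. (\<psi> has_real_derivative D) (at s) \<and> D \<le> 0" by blast
  qed simp
  then show ?thesis by (simp add: \<psi>_def bregman_def d_def)
qed

text \<open>
  Co-coercivity of the gradient. The function minus its tangent at \<open>y\<close> is nonnegative everywhere; a gradient step of
  length \<open>1 / L\<close> from \<open>x\<close> lowers it by at least the left-hand side, so its value at \<open>x\<close> cannot be smaller.
\<close>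

lemma bregman_ge_gradient_diff:
  assumes "convex_on UNIV f" and "L_smooth L f" and "0 < L"
  shows "(norm (gradient f x - gradient f y))\<^sup>2 / (2 * L) \<le> bregman f x y"
proof -
  define d where "d = gradient f x - gradient f y"
  \<comment> \<open>minimises the quadratic upper model of the function minus its tangent at \<open>y\<close>\<close>
  define z where "z = x - (1 / L) *\<^sub>R d"
  have "0 \<le> bregman f z y"
    using assms by (intro bregman_nonneg) (auto simp: L_smooth_def)
  moreover have "bregman f z x \<le> L / 2 * (norm (z - x))\<^sup>2"
    using assms(2) by (rule bregman_le_of_L_smooth)
  moreover have "L / 2 * (norm (z - x))\<^sup>2 = (norm d)\<^sup>2 / (2 * L)"
    using assms(3) by (simp add: z_def power_divide power2_eq_square)
  moreover have "bregman f x y = bregman f z y - bregman f z x + d \<bullet> (x - z)"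
    by (simp add: bregman_def d_def inner_diff_left inner_diff_right)
  moreover have "d \<bullet> (x - z) = (norm d)\<^sup>2 / L"
    by (simp add: z_def power2_norm_eq_inner)
  ultimately show ?thesis by (simp add: d_def field_simps)
qed

section \<open>Norm inequalities and a permuted sum\<close>

lemma norm_convex_combination_squared:
  fixes x y :: "'a::real_inner"
  assumes "0 \<le> c" "c \<le> 1"
  shows "(norm (c *\<^sub>R x + (1 - c) *\<^sub>R y))\<^sup>2 \<le> c * (norm x)\<^sup>2 + (1 - c) * (norm y)\<^sup>2"
proof -
  have "c * (norm x)\<^sup>2 + (1 - c) * (norm y)\<^sup>2 - (norm (c *\<^sub>R x + (1 - c) *\<^sub>R y))\<^sup>2
      = c * (1 - c) * (norm (x - y))\<^sup>2"
    by (simp add: power2_norm_eq_inner inner_add_left inner_add_right inner_diff_left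
        inner_diff_right inner_commute[of y x] algebra_simps)
  moreover have "0 \<le> c * (1 - c) * (norm (x - y))\<^sup>2" using assms by simp
  ultimately show ?thesis by linarith
qed

text \<open>
  The weights are Young's inequality with parameter \<open>3\<close>. The second vector will be the noise: with weight \<open>4\<close>
  it just meets the constant of the final bound, which leaves the gradient deviations a weight close to one.
\<close>

lemma norm_add_squared_le_weighted:
  fixes x y :: "'a::real_inner"
  shows "(norm (x + y))\<^sup>2 \<le> 4 / 3 * (norm x)\<^sup>2 + 4 * (norm y)\<^sup>2"
proof -
  have "4 / 3 * (norm x)\<^sup>2 + 4 * (norm y)\<^sup>2 - (norm (x + y))\<^sup>2 = (norm (x - 3 *\<^sub>R y))\<^sup>2 / 3"
    by (simp add: power2_norm_eq_inner inner_add_left inner_add_right inner_diff_left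
        inner_diff_right inner_commute[of y x] field_simps)
  moreover have "0 \<le> (norm (x - 3 *\<^sub>R y))\<^sup>2 / 3" by simp
  ultimately show ?thesis by linarith
qed

lemma norm_sum_squared_le_card:
  fixes x :: "'i \<Rightarrow> 'a::real_normed_vector"
  shows "(norm (\<Sum>j\<in>J. x j))\<^sup>2 \<le> card J * (\<Sum>j\<in>J. (norm (x j))\<^sup>2)"
proof -
  have "(norm (\<Sum>j\<in>J. x j))\<^sup>2 \<le> (\<Sum>j\<in>J. 1 * norm (x j))\<^sup>2"
    using norm_sum[of x J] by (intro power_mono) auto
  also have "\<dots> \<le> (\<Sum>j\<in>J. 1\<^sup>2) * (\<Sum>j\<in>J. (norm (x j))\<^sup>2)"
    by (rule Cauchy_Schwarz_ineq_sum)
  finally show ?thesis by simp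
qed

lemma sum_permuted_lessThan:
  fixes p :: "nat \<Rightarrow> nat"
  assumes "p permutes {1..n}"
  shows "(\<Sum>j<n. \<phi> (p (j + 1))) = (\<Sum>i=1..n. \<phi> i)"
proof -
  have "(\<Sum>j<n. \<phi> (p (j + 1))) = (\<Sum>i=1..n. \<phi> (p i))"
    by (rule sum.reindex_bij_witness[of _ "\<lambda>i. i - 1" "\<lambda>j. j + 1"]) auto
  also have "\<dots> = (\<Sum>i=1..n. \<phi> i)"
    using sum.permute[OF assms, of \<phi>] by (simp add: o_def)
  finally show ?thesis .
qed

lemma sum_lessThan_le_half_square:
  "(\<Sum>i<n. real i) \<le> (real n)\<^sup>2 / 2"
  by (induction n) (auto simp: power2_eq_square algebra_simps)

section \<open>One epoch of the algorithm\<close>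

text \<open>
  The factor \<open>N\<close> in the bounds for the momentum and the deviations cancels one of the two powers of the
  normalisation \<open>h / N\<close>; the noise term \<open>E\<close> keeps both.
\<close>

lemma displacement_scaling:
  fixes h k N b M D E :: real
  assumes "N \<noteq> 0"
  shows "(h / N)\<^sup>2 * (b * (k * (N * M)) + (1 - b) * (4 / 3 * (k * (N * D)) + 4 * E))
    = k / N * (h\<^sup>2 * (b * M + (1 - b) * (4 / 3 * D))) + 4 * (1 - b) * h\<^sup>2 * (E / N\<^sup>2)"
  using assms by (simp add: field_simps power2_eq_square)

text \<open>
  Each inner step adds the same multiple of the start momentum \<open>m0\<close>, since the momentum is refreshed only between
  epochs; hence its share of the displacement is linear in the number of steps, and the rest is a plain sum of gradients.
\<close>

lemma smg_inner_closed_form: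
  fixes f :: "nat \<Rightarrow> 'a::euclidean_space \<Rightarrow> real" and n :: nat
    and \<beta> h :: real and p :: "nat \<Rightarrow> nat" and w0 m0 :: 'a
  defines "w \<equiv> \<lambda>i. fst (smg_inner n f \<beta> h p w0 m0 i)"
  defines "g \<equiv> \<lambda>j. gradient (f (p (j + 1))) (w j)"
  shows smg_inner_point:
      "w i = w0 - (h / n) *\<^sub>R ((i * \<beta>) *\<^sub>R m0 + (1 - \<beta>) *\<^sub>R (\<Sum>j<i. g j))"
    and smg_inner_average:
      "snd (snd (smg_inner n f \<beta> h p w0 m0 i)) = (1 / n) *\<^sub>R (\<Sum>j<i. g j)"
proof (induction i)
  case 0
  { case 1 show ?case by (simp add: w_def) }
  { case 2 show ?case by simp }
next
  case (Suc i)
  have step: "w (Suc i) = w i - (h / n) *\<^sub>R (\<beta> *\<^sub>R m0 + (1 - \<beta>) *\<^sub>R g i)"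
    by (simp add: w_def g_def Let_def case_prod_beta)
  { case 1 show ?case by (simp only: step Suc.IH(1)) (simp add: algebra_simps) }
  { case 2
    have "snd (snd (smg_inner n f \<beta> h p w0 m0 (Suc i)))
        = snd (snd (smg_inner n f \<beta> h p w0 m0 i)) + (1 / n) *\<^sub>R g i"
      by (simp add: w_def g_def Let_def case_prod_beta)
    then show ?case by (simp only: Suc.IH(2)) (simp add: scaleR_right_distrib) }
qed

locale smooth_convex_sum =
  fixes n :: nat and f :: "nat \<Rightarrow> 'a::euclidean_space \<Rightarrow> real" and L :: real and wstar :: 'a
  assumes n_pos: "1 \<le> n" and L_pos: "0 < L"
    and convex: "\<And>i. i \<in> {1..n} \<Longrightarrow> convex_on UNIV (f i)"
    and smooth: "\<And>i. i \<in> {1..n} \<Longrightarrow> L_smooth L (f i)"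
    and minimizer: "\<And>w. finite_sum_objective n f wstar \<le> finite_sum_objective n f w"
begin

abbreviation F :: "'a \<Rightarrow> real" where
  "F \<equiv> finite_sum_objective n f"

definition gap :: "'a \<Rightarrow> real" where
  "gap w = F w - F wstar"

lemma gap_nonneg: "0 \<le> gap w"
  using minimizer[of w] by (simp add: gap_def)

text \<open>
  A step of length \<open>1 / (nL)\<close> against the gradient \<open>d\<close> of the sum would lower the sum by at least
  \<open>\<parallel>d\<parallel>\<^sup>2 / (2nL)\<close>, so minimality leaves only \<open>d = 0\<close>.
\<close>

lemma sum_gradient_minimizer: "(\<Sum>i=1..n. gradient (f i) wstar) = 0"
proof -
  define d where "d = (\<Sum>i=1..n. gradient (f i) wstar)"
  \<comment> \<open>the step that is optimal for the quadratic upper bound of the sum\<close>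
  define z where "z = wstar - (1 / (n * L)) *\<^sub>R d"
  have "(\<Sum>i=1..n. f i wstar) \<le> (\<Sum>i=1..n. f i z)"
    using minimizer[of z] n_pos by (simp add: finite_sum_objective_def divide_le_cancel)
  also have "\<dots> \<le> (\<Sum>i=1..n. f i wstar + gradient (f i) wstar \<bullet> (z - wstar)
      + L / 2 * (norm (z - wstar))\<^sup>2)"
  proof (intro sum_mono)
    fix i assume "i \<in> {1..n}"
    from bregman_le_of_L_smooth[OF smooth[OF this], of z wstar]
    show "f i z \<le> f i wstar + gradient (f i) wstar \<bullet> (z - wstar) + L / 2 * (norm (z - wstar))\<^sup>2"
      by (simp add: bregman_def)
  qed
  also have "\<dots> = (\<Sum>i=1..n. f i wstar) + d \<bullet> (z - wstar) + n * (L / 2 * (norm (z - wstar))\<^sup>2)"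
    by (simp add: sum.distrib d_def inner_sum_left)
  also have "d \<bullet> (z - wstar) = - ((norm d)\<^sup>2 / (n * L))"
    by (simp add: z_def dot_square_norm)
  also have "n * (L / 2 * (norm (z - wstar))\<^sup>2) = (norm d)\<^sup>2 / (n * L) / 2"
    using n_pos L_pos by (simp add: z_def power_divide power2_eq_square)
  finally have "(norm d)\<^sup>2 / (2 * (L * n)) \<le> 0" by simp
  then have "(norm d)\<^sup>2 \<le> 0"
    using n_pos L_pos by (simp add: divide_le_0_iff mult_le_0_iff)
  then show ?thesis by (simp add: d_def)
qed

text \<open>
  The quantity \<open>S\<close> of the overview. Of the factor \<open>n\<^sup>3\<close>, \<open>n\<^sup>2\<close> comes from the inner step size and \<open>n\<close> from averaging over
  the inner iterates.
\<close>

definition prefix_energy :: "(nat \<Rightarrow> nat) \<Rightarrow> real" where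
  "prefix_energy p = (\<Sum>i<n. (norm (\<Sum>j<i. gradient (f (p (j + 1))) wstar))\<^sup>2) / n ^ 3"

lemma prefix_energy_nonneg: "0 \<le> prefix_energy p"
  by (simp add: prefix_energy_def sum_nonneg)

end

locale smg_single_epoch = smooth_convex_sum n f L wstar
  for n :: nat and f :: "nat \<Rightarrow> 'a::euclidean_space \<Rightarrow> real" and L :: real and wstar :: 'a +
  fixes \<beta> h :: real and p :: "nat \<Rightarrow> nat" and w0 m0 :: 'a
  assumes beta: "0 \<le> \<beta>" "\<beta> < 1" and p: "p permutes {1..n}"
begin

definition w :: "nat \<Rightarrow> 'a" where
  "w i = fst (smg_inner n f \<beta> h p w0 m0 i)"

definition g :: "nat \<Rightarrow> 'a" where
  "g j = gradient (f (p (j + 1))) (w j)"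

definition gstar :: "nat \<Rightarrow> 'a" where
  "gstar j = gradient (f (p (j + 1))) wstar"

definition m :: 'a where
  "m = snd (snd (smg_inner n f \<beta> h p w0 m0 n))"

definition deviation :: real where
  "deviation = (\<Sum>j<n. (norm (g j - gstar j))\<^sup>2) / n"

lemma deviation_nonneg: "0 \<le> deviation"
  by (simp add: deviation_def sum_nonneg)

lemma p_mem: "j < n \<Longrightarrow> p (j + 1) \<in> {1..n}"
  by (subst permutes_in_image[OF p]) simp

lemma sum_gstar: "(\<Sum>j<n. gstar j) = 0"
  unfolding gstar_def
  using sum_permuted_lessThan[OF p, of "\<lambda>i. gradient (f i) wstar"] sum_gradient_minimizer by simp

lemma point_eq: "w i = w0 - (h / n) *\<^sub>R ((i * \<beta>) *\<^sub>R m0 + (1 - \<beta>) *\<^sub>R (\<Sum>j<i. g j))"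
  unfolding w_def g_def by (rule smg_inner_point)

lemma m_eq: "m = (1 / n) *\<^sub>R (\<Sum>j<n. g j)"
  unfolding m_def w_def g_def by (rule smg_inner_average)

lemma end_point_eq: "w n = w0 - h *\<^sub>R (\<beta> *\<^sub>R m0 + (1 - \<beta>) *\<^sub>R m)"
proof -
  have "(\<Sum>j<n. g j) = real n *\<^sub>R m" using n_pos by (simp add: m_eq)
  then show ?thesis using n_pos by (simp add: point_eq scaleR_add_right)
qed

text \<open>
  The average gradient can be centred for free because the gradients at the minimiser sum to zero.
\<close>

lemma norm_m_squared_le: "(norm m)\<^sup>2 \<le> deviation"
proof -
  have "m = (1 / n) *\<^sub>R (\<Sum>j<n. g j - gstar j)"
    by (simp add: m_eq sum_subtractf sum_gstar)
  then have "(norm m)\<^sup>2 = (norm (\<Sum>j<n. g j - gstar j))\<^sup>2 / n\<^sup>2"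
    by (simp add: power_divide)
  also have "\<dots> \<le> (card {..<n} * (\<Sum>j<n. (norm (g j - gstar j))\<^sup>2)) / n\<^sup>2"
    by (intro divide_right_mono norm_sum_squared_le_card) simp
  also have "\<dots> = deviation"
    using n_pos by (simp add: deviation_def power2_eq_square)
  finally show ?thesis .
qed

text \<open>
  The Bregman identity of the overview, averaged over the epoch. The comparison point \<open>z\<close> is arbitrary: it will be
  the start of the epoch for the fresh momentum and its end for the stale one.
\<close>

lemma inner_m_ge:
  "gap z + deviation / (2 * L) - L / 2 * ((\<Sum>i<n. (norm (z - w i))\<^sup>2) / n) \<le> m \<bullet> (z - wstar)"
proof -
  have "(\<Sum>i<n. f (p (i + 1)) z - f (p (i + 1)) wstar + (norm (g i - gstar i))\<^sup>2 / (2 * L)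
        - L / 2 * (norm (z - w i))\<^sup>2) \<le> (\<Sum>i<n. g i \<bullet> (z - wstar))"
  proof (rule sum_mono)
    fix i assume "i \<in> {..<n}"
    then have i: "p (i + 1) \<in> {1..n}" using p_mem by simp
    have "(norm (g i - gstar i))\<^sup>2 / (2 * L) \<le> bregman (f (p (i + 1))) wstar (w i)"
      using bregman_ge_gradient_diff[OF convex[OF i] smooth[OF i] L_pos, of wstar "w i"]
      by (simp add: g_def gstar_def norm_minus_commute)
    moreover have "bregman (f (p (i + 1))) z (w i) \<le> L / 2 * (norm (z - w i))\<^sup>2"
      by (rule bregman_le_of_L_smooth[OF smooth[OF i]])
    ultimately show "f (p (i + 1)) z - f (p (i + 1)) wstar + (norm (g i - gstar i))\<^sup>2 / (2 * L)
        - L / 2 * (norm (z - w i))\<^sup>2 \<le> g i \<bullet> (z - wstar)"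
      by (simp add: bregman_def g_def inner_diff_right)
  qed
  then have "(\<Sum>i=1..n. f i z) - (\<Sum>i=1..n. f i wstar)
        + (\<Sum>i<n. (norm (g i - gstar i))\<^sup>2) / (2 * L)
        - L / 2 * (\<Sum>i<n. (norm (z - w i))\<^sup>2) \<le> (\<Sum>i<n. g i) \<bullet> (z - wstar)"
    by (simp only: sum.distrib sum_subtractf sum_permuted_lessThan[OF p, of "\<lambda>i. f i z"]
        sum_permuted_lessThan[OF p, of "\<lambda>i. f i wstar"] inner_sum_left sum_distrib_left
        sum_divide_distrib)
  then have "((\<Sum>i=1..n. f i z) - (\<Sum>i=1..n. f i wstar)
        + (\<Sum>i<n. (norm (g i - gstar i))\<^sup>2) / (2 * L)
        - L / 2 * (\<Sum>i<n. (norm (z - w i))\<^sup>2)) / n \<le> ((\<Sum>i<n. g i) \<bullet> (z - wstar)) / n"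
    by (rule divide_right_mono) simp
  moreover have "((\<Sum>i<n. g i) \<bullet> (z - wstar)) / n = m \<bullet> (z - wstar)"
    by (simp add: m_eq)
  moreover have "((\<Sum>i=1..n. f i z) - (\<Sum>i=1..n. f i wstar)) / n = gap z"
    by (simp add: gap_def finite_sum_objective_def diff_divide_distrib)
  moreover have "(\<Sum>i<n. (norm (g i - gstar i))\<^sup>2) / (2 * L) / n = deviation / (2 * L)"
    by (simp add: deviation_def)
  ultimately show ?thesis
    by (simp only: add_divide_distrib diff_divide_distrib times_divide_eq_right)
qed

text \<open>
  The displacement caused by a block \<open>J\<close> of inner steps. Initial blocks give the distances from the start of the epoch,
  final blocks the distances from its end.
\<close>

lemma displacement_le:
  assumes "J \<subseteq> {..<n}"
  shows "(norm ((h / n) *\<^sub>R ((card J * \<beta>) *\<^sub>R m0 + (1 - \<beta>) *\<^sub>R (\<Sum>j\<in>J. g j))))\<^sup>2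
    \<le> card J / n * (h\<^sup>2 * (\<beta> * (norm m0)\<^sup>2 + (1 - \<beta>) * (4 / 3 * deviation)))
      + 4 * (1 - \<beta>) * h\<^sup>2 * ((norm (\<Sum>j\<in>J. gstar j))\<^sup>2 / n\<^sup>2)"
proof -
  have card: "real (card J) \<le> n"
    using card_mono[OF _ assms] by simp
  have "(norm (\<Sum>j\<in>J. g j - gstar j))\<^sup>2 \<le> card J * (\<Sum>j\<in>J. (norm (g j - gstar j))\<^sup>2)"
    by (rule norm_sum_squared_le_card)
  also have "\<dots> \<le> card J * (\<Sum>j<n. (norm (g j - gstar j))\<^sup>2)"
    using assms by (intro mult_left_mono sum_mono2) auto
  also have "\<dots> = card J * (n * deviation)"
    using n_pos by (simp add: deviation_def)
  finally have dev: "(norm (\<Sum>j\<in>J. g j - gstar j))\<^sup>2 \<le> card J * (n * deviation)" .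
  have "(norm (\<Sum>j\<in>J. g j))\<^sup>2 = (norm ((\<Sum>j\<in>J. g j - gstar j) + (\<Sum>j\<in>J. gstar j)))\<^sup>2"
    by (simp add: sum_subtractf)
  also have "\<dots> \<le> 4 / 3 * (norm (\<Sum>j\<in>J. g j - gstar j))\<^sup>2 + 4 * (norm (\<Sum>j\<in>J. gstar j))\<^sup>2"
    by (rule norm_add_squared_le_weighted)
  finally have own: "(norm (\<Sum>j\<in>J. g j))\<^sup>2
      \<le> 4 / 3 * (card J * (n * deviation)) + 4 * (norm (\<Sum>j\<in>J. gstar j))\<^sup>2"
    using dev by linarith
  have mom: "(norm (card J *\<^sub>R m0))\<^sup>2 \<le> card J * (n * (norm m0)\<^sup>2)"
  proof -
    have "real (card J) * (card J * (norm m0)\<^sup>2) \<le> card J * (n * (norm m0)\<^sup>2)"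
      using card by (intro mult_left_mono mult_right_mono) auto
    then show ?thesis
      by (simp add: power_mult_distrib power2_eq_square[of "real (card J)"] mult.assoc)
  qed
  have "(norm (\<beta> *\<^sub>R (card J *\<^sub>R m0) + (1 - \<beta>) *\<^sub>R (\<Sum>j\<in>J. g j)))\<^sup>2
      \<le> \<beta> * (norm (card J *\<^sub>R m0))\<^sup>2 + (1 - \<beta>) * (norm (\<Sum>j\<in>J. g j))\<^sup>2"
    using beta by (intro norm_convex_combination_squared) auto
  also have "\<dots> \<le> \<beta> * (card J * (n * (norm m0)\<^sup>2))
      + (1 - \<beta>) * (4 / 3 * (card J * (n * deviation)) + 4 * (norm (\<Sum>j\<in>J. gstar j))\<^sup>2)"
    using beta by (intro add_mono mult_left_mono own mom) auto
  finally have "(h / n)\<^sup>2 * (norm (\<beta> *\<^sub>R (card J *\<^sub>R m0) + (1 - \<beta>) *\<^sub>R (\<Sum>j\<in>J. g j)))\<^sup>2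
      \<le> (h / n)\<^sup>2 * (\<beta> * (card J * (n * (norm m0)\<^sup>2))
      + (1 - \<beta>) * (4 / 3 * (card J * (n * deviation)) + 4 * (norm (\<Sum>j\<in>J. gstar j))\<^sup>2))"
    by (rule mult_left_mono) simp
  moreover have "(norm ((h / n) *\<^sub>R ((card J * \<beta>) *\<^sub>R m0 + (1 - \<beta>) *\<^sub>R (\<Sum>j\<in>J. g j))))\<^sup>2
      = (h / n)\<^sup>2 * (norm (\<beta> *\<^sub>R (card J *\<^sub>R m0) + (1 - \<beta>) *\<^sub>R (\<Sum>j\<in>J. g j)))\<^sup>2"
    by (simp add: power_mult_distrib power_divide mult.commute)
  moreover have "(h / n)\<^sup>2 * (\<beta> * (card J * (n * (norm m0)\<^sup>2))
      + (1 - \<beta>) * (4 / 3 * (card J * (n * deviation)) + 4 * (norm (\<Sum>j\<in>J. gstar j))\<^sup>2))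
    = card J / n * (h\<^sup>2 * (\<beta> * (norm m0)\<^sup>2 + (1 - \<beta>) * (4 / 3 * deviation)))
      + 4 * (1 - \<beta>) * h\<^sup>2 * ((norm (\<Sum>j\<in>J. gstar j))\<^sup>2 / n\<^sup>2)"
    using displacement_scaling[of "real n"] n_pos by simp
  ultimately show ?thesis by simp
qed

lemma sum_prefix_norms: "(\<Sum>i<n. (norm (\<Sum>j<i. gstar j))\<^sup>2 / n\<^sup>2) / n = prefix_energy p"
  by (simp add: prefix_energy_def gstar_def power3_eq_cube power2_eq_square
      sum_divide_distrib[symmetric] mult.assoc)

text \<open>
  The first \<open>i\<close> steps carry the weight \<open>i / n\<close>, whose average is at most one half. This factor is needed when the
  losses are compared with the gains.
\<close>

lemma average_displacement_from_start:
  "(\<Sum>i<n. (norm (w0 - w i))\<^sup>2) / n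
    \<le> h\<^sup>2 * ((\<beta> * (norm m0)\<^sup>2 + (1 - \<beta>) * (4 / 3 * deviation)) / 2
        + 4 * (1 - \<beta>) * prefix_energy p)"
proof -
  define R where "R = h\<^sup>2 * (\<beta> * (norm m0)\<^sup>2 + (1 - \<beta>) * (4 / 3 * deviation))"
  have R: "0 \<le> R" using beta deviation_nonneg by (simp add: R_def)
  have "(\<Sum>i<n. (norm (w0 - w i))\<^sup>2)
      \<le> (\<Sum>i<n. i / n * R + 4 * (1 - \<beta>) * h\<^sup>2 * ((norm (\<Sum>j<i. gstar j))\<^sup>2 / n\<^sup>2))"
  proof (rule sum_mono)
    fix i assume "i \<in> {..<n}"
    then have "{..<i} \<subseteq> {..<n}" by auto
    from displacement_le[OF this]
    show "(norm (w0 - w i))\<^sup>2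
        \<le> i / n * R + 4 * (1 - \<beta>) * h\<^sup>2 * ((norm (\<Sum>j<i. gstar j))\<^sup>2 / n\<^sup>2)"
      by (simp add: point_eq R_def)
  qed
  also have "\<dots> = (\<Sum>i<n. real i) / n * R
      + 4 * (1 - \<beta>) * h\<^sup>2 * (\<Sum>i<n. (norm (\<Sum>j<i. gstar j))\<^sup>2 / n\<^sup>2)"
    by (simp only: sum.distrib sum_distrib_left sum_distrib_right sum_divide_distrib)
  finally have "(\<Sum>i<n. (norm (w0 - w i))\<^sup>2) / n \<le> ((\<Sum>i<n. real i) / n * R
      + 4 * (1 - \<beta>) * h\<^sup>2 * (\<Sum>i<n. (norm (\<Sum>j<i. gstar j))\<^sup>2 / n\<^sup>2)) / n"
    by (rule divide_right_mono) simp
  also have "\<dots> = (\<Sum>i<n. real i) / n\<^sup>2 * R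
      + 4 * (1 - \<beta>) * h\<^sup>2 * ((\<Sum>i<n. (norm (\<Sum>j<i. gstar j))\<^sup>2 / n\<^sup>2) / n)"
    by (simp add: add_divide_distrib power2_eq_square)
  also have "\<dots> = (\<Sum>i<n. real i) / n\<^sup>2 * R + 4 * (1 - \<beta>) * h\<^sup>2 * prefix_energy p"
    by (simp only: sum_prefix_norms)
  also have "\<dots> \<le> 1 / 2 * R + 4 * (1 - \<beta>) * h\<^sup>2 * prefix_energy p"
    using sum_lessThan_le_half_square[of n] n_pos R
    by (intro add_right_mono mult_right_mono) (auto simp: field_simps)
  also have "\<dots> = h\<^sup>2 * ((\<beta> * (norm m0)\<^sup>2 + (1 - \<beta>) * (4 / 3 * deviation)) / 2
        + 4 * (1 - \<beta>) * prefix_energy p)"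
    by (simp add: R_def field_simps)
  finally show ?thesis .
qed

text \<open>
  The steps after \<open>i\<close> move the iterate to the end of the epoch. Since the gradients at the minimiser sum to zero over
  the epoch, their sum over a final block is minus that over the complementary initial block, so the same prefix
  energy appears.
\<close>

lemma average_displacement_from_end:
  "(\<Sum>i<n. (norm (w n - w i))\<^sup>2) / n
    \<le> h\<^sup>2 * (\<beta> * (norm m0)\<^sup>2 + (1 - \<beta>) * (4 / 3 * deviation)
        + 4 * (1 - \<beta>) * prefix_energy p)"
proof -
  define R where "R = h\<^sup>2 * (\<beta> * (norm m0)\<^sup>2 + (1 - \<beta>) * (4 / 3 * deviation))"
  have R: "0 \<le> R" using beta deviation_nonneg by (simp add: R_def)
  have "(\<Sum>i<n. (norm (w n - w i))\<^sup>2)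
      \<le> (\<Sum>i<n. R + 4 * (1 - \<beta>) * h\<^sup>2 * ((norm (\<Sum>j<i. gstar j))\<^sup>2 / n\<^sup>2))"
  proof (rule sum_mono)
    fix i assume "i \<in> {..<n}"
    then have i: "i < n" by simp
    have split: "(\<Sum>j<n. x j) = (\<Sum>j<i. x j) + (\<Sum>j\<in>{i..<n}. x j)" for x :: "nat \<Rightarrow> 'a"
      using i by (simp add: sum.atLeastLessThan_concat lessThan_atLeast0)
    have "w n - w i = - ((h / n) *\<^sub>R ((card {i..<n} * \<beta>) *\<^sub>R m0 + (1 - \<beta>) *\<^sub>R (\<Sum>j\<in>{i..<n}. g j)))"
      using i unfolding point_eq split[of g] by (simp add: algebra_simps of_nat_diff)
    then have "(norm (w n - w i))\<^sup>2
        = (norm ((h / n) *\<^sub>R ((card {i..<n} * \<beta>) *\<^sub>R m0 + (1 - \<beta>) *\<^sub>R (\<Sum>j\<in>{i..<n}. g j))))\<^sup>2"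
      by (simp only: norm_minus_cancel)
    also have "\<dots> \<le> card {i..<n} / n * R
        + 4 * (1 - \<beta>) * h\<^sup>2 * ((norm (\<Sum>j\<in>{i..<n}. gstar j))\<^sup>2 / n\<^sup>2)"
      unfolding R_def by (rule displacement_le) auto
    also have "(\<Sum>j\<in>{i..<n}. gstar j) = - (\<Sum>j<i. gstar j)"
      using split[of gstar] by (simp add: sum_gstar eq_neg_iff_add_eq_0 add.commute)
    also have "card {i..<n} / n * R \<le> 1 * R"
      using R n_pos by (intro mult_right_mono) auto
    finally show "(norm (w n - w i))\<^sup>2
        \<le> R + 4 * (1 - \<beta>) * h\<^sup>2 * ((norm (\<Sum>j<i. gstar j))\<^sup>2 / n\<^sup>2)"
      by simp
  qed
  also have "\<dots> = n * R + 4 * (1 - \<beta>) * h\<^sup>2 * (\<Sum>i<n. (norm (\<Sum>j<i. gstar j))\<^sup>2 / n\<^sup>2)"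
    by (simp add: sum.distrib sum_distrib_left)
  finally have "(\<Sum>i<n. (norm (w n - w i))\<^sup>2) / n \<le> (n * R
      + 4 * (1 - \<beta>) * h\<^sup>2 * (\<Sum>i<n. (norm (\<Sum>j<i. gstar j))\<^sup>2 / n\<^sup>2)) / n"
    by (rule divide_right_mono) simp
  also have "\<dots> = R + 4 * (1 - \<beta>) * h\<^sup>2 * ((\<Sum>i<n. (norm (\<Sum>j<i. gstar j))\<^sup>2 / n\<^sup>2) / n)"
    using n_pos by (simp add: add_divide_distrib)
  also have "\<dots> = R + 4 * (1 - \<beta>) * h\<^sup>2 * prefix_energy p"
    by (simp only: sum_prefix_norms)
  finally show ?thesis by (simp add: R_def algebra_simps)
qed

lemma inner_m_start_ge:
  "gap w0 + deviation / (2 * L)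
      - L / 2 * (h\<^sup>2 * ((\<beta> * (norm m0)\<^sup>2 + (1 - \<beta>) * (4 / 3 * deviation)) / 2
          + 4 * (1 - \<beta>) * prefix_energy p))
    \<le> m \<bullet> (w0 - wstar)"
proof -
  have "L / 2 * ((\<Sum>i<n. (norm (w0 - w i))\<^sup>2) / n)
      \<le> L / 2 * (h\<^sup>2 * ((\<beta> * (norm m0)\<^sup>2 + (1 - \<beta>) * (4 / 3 * deviation)) / 2
          + 4 * (1 - \<beta>) * prefix_energy p))"
    using L_pos by (intro mult_left_mono average_displacement_from_start) simp
  with inner_m_ge[of w0] show ?thesis by linarith
qed

lemma inner_m_end_ge:
  "deviation / (2 * L)
      - L / 2 * (h\<^sup>2 * (\<beta> * (norm m0)\<^sup>2 + (1 - \<beta>) * (4 / 3 * deviation)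
          + 4 * (1 - \<beta>) * prefix_energy p))
    \<le> m \<bullet> (w n - wstar)"
proof -
  have "L / 2 * ((\<Sum>i<n. (norm (w n - w i))\<^sup>2) / n)
      \<le> L / 2 * (h\<^sup>2 * (\<beta> * (norm m0)\<^sup>2 + (1 - \<beta>) * (4 / 3 * deviation)
          + 4 * (1 - \<beta>) * prefix_energy p))"
    using L_pos by (intro mult_left_mono average_displacement_from_end) simp
  with inner_m_ge[of "w n"] gap_nonneg[of "w n"] show ?thesis by linarith
qed

end

section \<open>Descent over all epochs\<close>

text \<open>
  The balance of one epoch. Here \<open>G'\<close> and \<open>G\<close> are the deviations of the previous and the current epoch, \<open>X\<close> and \<open>Y\<close>
  the products of stale and fresh momentum with the current error vector, and \<open>U\<close> the delayed loss booked earlier.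
  With the step size bounds, \<open>h\<^sup>2\<close> and \<open>L h\<^sup>3\<close> become multiples of \<open>q = h / L\<close>, the unit of the gains. The
  coefficients of \<open>G'\<close> and \<open>G\<close> are then at most zero, and the noise \<open>S\<close>, now and delayed, costs at most
  \<open>4 K L h\<^sup>3\<close>.
\<close>

lemma epoch_arithmetic:
  fixes h L K b G G' S X Y U D gp :: real
  assumes h: "0 < h" and L: "0 < L" and K: "1 \<le> K"
    and hL: "h * L \<le> 1 / 2" and hLK: "K * (h * L)\<^sup>2 \<le> 1 / 4"
    and b: "0 \<le> b" "b \<le> 1" and nonneg: "0 \<le> G" "0 \<le> G'" "0 \<le> S"
    and X: "- (2 * h * b * X) \<le> U - h * b * G' / L + h * b * (1 - b) * G' / (3 * K * L)"
    and Y: "gp + G / (2 * L) - L / 2 * (h\<^sup>2 * ((b * G' + (1 - b) * (4 / 3 * G)) / 2 + 4 * (1 - b) * S)) \<le> Y"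
  shows "D - 2 * h * (b * X + (1 - b) * Y) + h\<^sup>2 * (b * G' + (1 - b) * G)
      + (K - 1) * L * h ^ 3 * (b * G' + 4 * (1 - b) * S) + 2 * h * (1 - b) * gp
    \<le> D + U + 4 * K * L * h ^ 3 * S"
proof -
  define q where "q = h / L"
  have q: "0 < q" using h L by (simp add: q_def)
  \<comment> \<open>these bounds express every loss in the unit \<open>q\<close> of the gains\<close>
  have h2: "h\<^sup>2 \<le> q * (1 / 2)"
    using hL h L by (simp add: q_def field_simps power2_eq_square)
  have h3: "L * h ^ 3 \<le> q * (1 / (4 * K))"
    using hLK h L K by (simp add: q_def field_simps power2_eq_square power3_eq_cube)
  have h3_4: "L * h ^ 3 \<le> q * (1 / 4)"
  proof -
    have "q * (1 / (4 * K)) \<le> q * (1 / 4)"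
      using q K by (intro mult_left_mono) (auto simp: field_simps)
    with h3 show ?thesis by linarith
  qed
  have cG': "- q + q * ((1 - b) / (3 * K)) + (1 - b) / 2 * (L * h ^ 3) + h\<^sup>2
      + (K - 1) * (L * h ^ 3) \<le> 0"
  proof -
    have "(1 - b) / 2 * (L * h ^ 3) \<le> (1 - b) / 2 * (q * (1 / (4 * K)))"
      using b h3 by (intro mult_left_mono) auto
    moreover have "(K - 1) * (L * h ^ 3) \<le> (K - 1) * (q * (1 / (4 * K)))"
      using K h3 by (intro mult_left_mono) auto
    moreover have "- q + q * ((1 - b) / (3 * K)) + (1 - b) / 2 * (q * (1 / (4 * K)))
        + q * (1 / 2) + (K - 1) * (q * (1 / (4 * K)))
        = q * (- (6 * K - 5 + 11 * b) / (24 * K))"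
      using K L by (simp add: field_simps)
    moreover have "q * (- (6 * K - 5 + 11 * b) / (24 * K)) \<le> 0"
      using K q b by (intro mult_nonneg_nonpos) (auto simp: divide_le_0_iff)
    ultimately show ?thesis using h2 by linarith
  qed
  have cG: "- q + 2 / 3 * (1 - b) * (L * h ^ 3) + h\<^sup>2 \<le> 0"
  proof -
    have "2 / 3 * (1 - b) * (L * h ^ 3) \<le> 2 / 3 * (L * h ^ 3)"
      using b h L by (intro mult_right_mono) auto
    also have "\<dots> \<le> 2 / 3 * (q * (1 / 4))"
      by (intro mult_left_mono h3_4) simp
    finally have "2 / 3 * (1 - b) * (L * h ^ 3) \<le> 1 / 6 * q" by simp
    then show ?thesis using h2 q by linarith
  qed
  have cS: "4 * (1 - b) * ((1 - b) + (K - 1)) * (L * h ^ 3) \<le> 4 * K * (L * h ^ 3)"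
  proof (intro mult_right_mono)
    show "4 * (1 - b) * ((1 - b) + (K - 1)) \<le> 4 * K"
    proof -
      have "(1 - b) * (K - b) \<le> 1 * K" using b K by (intro mult_mono) auto
      moreover have "4 * (1 - b) * ((1 - b) + (K - 1)) = 4 * ((1 - b) * (K - b))" by algebra
      ultimately show ?thesis by linarith
    qed
    show "0 \<le> L * h ^ 3" using L h by simp
  qed
  have "2 * h * (1 - b) * (gp + G / (2 * L)
      - L / 2 * (h\<^sup>2 * ((b * G' + (1 - b) * (4 / 3 * G)) / 2 + 4 * (1 - b) * S)))
      \<le> 2 * h * (1 - b) * Y"
    using h b by (intro mult_left_mono Y) auto
  moreover have "2 * h * (1 - b) * (gp + G / (2 * L)
      - L / 2 * (h\<^sup>2 * ((b * G' + (1 - b) * (4 / 3 * G)) / 2 + 4 * (1 - b) * S)))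
     = 2 * h * (1 - b) * gp + (1 - b) * G * q
      - (b * G') * ((1 - b) / 2 * (L * h ^ 3))
      - (1 - b) * G * (2 / 3 * (1 - b) * (L * h ^ 3))
      - 4 * (1 - b) * (1 - b) * (L * h ^ 3) * S"
    using L by (simp add: q_def field_simps power2_eq_square power3_eq_cube)
  moreover have "h * b * G' / L = (b * G') * q" by (simp add: q_def)
  moreover have "h * b * (1 - b) * G' / (3 * K * L) = (b * G') * (q * ((1 - b) / (3 * K)))"
    using K L by (simp add: q_def field_simps)
  moreover have "(b * G') * (- q + q * ((1 - b) / (3 * K)) + (1 - b) / 2 * (L * h ^ 3)
      + h\<^sup>2 + (K - 1) * (L * h ^ 3)) \<le> 0"
    using b nonneg by (intro mult_nonneg_nonpos cG') auto
  moreover have "((1 - b) * G) * (- q + 2 / 3 * (1 - b) * (L * h ^ 3) + h\<^sup>2) \<le> 0"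
    using b nonneg by (intro mult_nonneg_nonpos cG) auto
  moreover have "4 * (1 - b) * ((1 - b) + (K - 1)) * (L * h ^ 3) * S \<le> 4 * K * (L * h ^ 3) * S"
    using nonneg by (intro mult_right_mono cS)
  ultimately show ?thesis using X by (simp add: algebra_simps)
qed

locale smg_run = smooth_convex_sum n f L wstar
  for n :: nat and f :: "nat \<Rightarrow> 'a::euclidean_space \<Rightarrow> real" and L :: real and wstar :: 'a +
  fixes \<alpha> \<beta> K :: real and \<eta> :: "nat \<Rightarrow> real" and T :: nat
    and \<pi> :: "nat \<Rightarrow> nat \<Rightarrow> nat" and x :: 'a
  assumes beta: "0 \<le> \<beta>" "\<beta> < 1" and alpha: "0 < \<alpha>" and K: "K = 1 + \<alpha> * \<beta>"
    and eta_ratio: "\<And>t. t \<in> {2..T} \<Longrightarrow> \<eta> t \<le> \<alpha> * \<eta> (t - 1)"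
    and eta_bound: "\<And>t. t \<in> {1..T} \<Longrightarrow> 0 < \<eta> t \<and> \<eta> t \<le> 1 / (2 * L * sqrt K)"
    and perm: "\<And>t. t \<in> {1..T} \<Longrightarrow> \<pi> t permutes {1..n}"
begin

definition W :: "nat \<Rightarrow> 'a" where
  "W t = smg_iterate n f \<beta> \<eta> \<pi> x t"

definition momentum :: "nat \<Rightarrow> 'a" where
  "momentum t = snd (smg_epoch n f \<beta> \<eta> \<pi> x t)"

text \<open>
  Zero for \<open>t = 0\<close>: no epoch precedes the first one, and the initial momentum vanishes.
\<close>

definition dev :: "nat \<Rightarrow> real" where
  "dev t = (case t of 0 \<Rightarrow> 0
    | Suc s \<Rightarrow> smg_single_epoch.deviation n f wstar \<beta> (\<eta> t) (\<pi> t) (W s) (momentum s))"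

text \<open>
  The part of the loss of epoch \<open>t\<close> that occurs in epoch \<open>t + 1\<close>, when the momentum of epoch \<open>t\<close> is applied once more.
  The factor \<open>\<alpha>\<close> replaces the next learning rate, so that \<open>carry\<close> refers to the past only.
\<close>

definition carry :: "nat \<Rightarrow> real" where
  "carry t = (case t of 0 \<Rightarrow> 0
    | Suc s \<Rightarrow> \<alpha> * \<beta> * L * (\<eta> t) ^ 3 * (\<beta> * dev s + 4 * (1 - \<beta>) * prefix_energy (\<pi> t)))"

definition potential :: "nat \<Rightarrow> real" where
  "potential t = (norm (W t - wstar))\<^sup>2 + carry t"

lemma K_ge_1: "1 \<le> K"
  using K alpha beta by simp

lemma eta_times_L:
  assumes "t \<in> {1..T}"
  shows "K * (\<eta> t * L)\<^sup>2 \<le> 1 / 4" and "\<eta> t * L \<le> 1 / 2"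
proof -
  have K0: "0 < K" "0 < sqrt K" using K_ge_1 by auto
  have "\<eta> t * L \<le> 1 / (2 * L * sqrt K) * L"
    using eta_bound[OF assms] L_pos by (intro mult_right_mono) auto
  also have "\<dots> = 1 / (2 * sqrt K)" using L_pos by simp
  finally have *: "\<eta> t * L \<le> 1 / (2 * sqrt K)" .
  also have "\<dots> \<le> 1 / 2" using K_ge_1 by (simp add: field_simps)
  finally show "\<eta> t * L \<le> 1 / 2" .
  have "(\<eta> t * L)\<^sup>2 \<le> (1 / (2 * sqrt K))\<^sup>2"
    using * eta_bound[OF assms] L_pos by (intro power_mono) auto
  then show "K * (\<eta> t * L)\<^sup>2 \<le> 1 / 4"
    using K0 by (simp add: power_divide power_mult_distrib field_simps)
qed

lemma single_epoch:
  assumes "t < T"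
  shows "smg_single_epoch n f L wstar \<beta> (\<pi> (Suc t))"
  using assms perm[of "Suc t"] by unfold_locales (auto simp: beta)

lemma W_Suc: "W (Suc t) = smg_single_epoch.w n f \<beta> (\<eta> (Suc t)) (\<pi> (Suc t)) (W t) (momentum t) n"
  if "t < T"
  using that by (simp add: W_def momentum_def smg_iterate_def case_prod_beta
      smg_single_epoch.w_def[OF single_epoch])

lemma momentum_Suc:
  "momentum (Suc t) = smg_single_epoch.m n f \<beta> (\<eta> (Suc t)) (\<pi> (Suc t)) (W t) (momentum t)"
  if "t < T"
  using that by (simp add: W_def momentum_def smg_iterate_def case_prod_beta
      smg_single_epoch.m_def[OF single_epoch])

lemma momentum_le_dev: "t \<le> T \<Longrightarrow> (norm (momentum t))\<^sup>2 \<le> dev t"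
  by (cases t) (auto simp: momentum_Suc dev_def smg_single_epoch.norm_m_squared_le[OF single_epoch],
      simp add: momentum_def)

lemma dev_nonneg: "t \<le> T \<Longrightarrow> 0 \<le> dev t"
  using momentum_le_dev[of t] zero_le_power2[of "norm (momentum t)"] by linarith

lemma carry_nonneg:
  assumes "t \<le> T"
  shows "0 \<le> carry t"
proof (cases t)
  case (Suc s)
  then have "0 \<le> \<beta> * dev s + 4 * (1 - \<beta>) * prefix_energy (\<pi> t)" and "0 \<le> \<eta> t"
    using assms beta dev_nonneg[of s] prefix_energy_nonneg[of "\<pi> t"] eta_bound[of t] by auto
  then show ?thesis using alpha beta L_pos by (simp add: carry_def Suc)
qed (simp add: carry_def)

text \<open>
  The stale momentum is the average gradient of the previous epoch, which ended at the current point, so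
  \<open>inner_m_end_ge\<close> applies to that epoch. Its losses from the epoch before and from the noise are exactly what
  \<open>carry\<close> has reserved.
\<close>

lemma stale_momentum_bound:
  assumes t: "t < T"
  shows "- (2 * \<eta> (Suc t) * \<beta> * (momentum t \<bullet> (W t - wstar)))
    \<le> carry t - \<eta> (Suc t) * \<beta> * dev t / L + \<eta> (Suc t) * \<beta> * (1 - \<beta>) * dev t / (3 * K * L)"
proof (cases t)
  case 0
  then show ?thesis by (simp add: momentum_def carry_def dev_def)
next
  case (Suc s)
  then have s: "s < T" using t by simp
  interpret smg_single_epoch n f L wstar \<beta> "\<eta> t" "\<pi> t" "W s" "momentum s"
    using single_epoch[OF s] Suc by simp
  define e where "e = \<eta> t"
  define h where "h = \<eta> (Suc t)"
  have e: "0 < e" and h: "0 < h" using eta_bound[of t] eta_bound[of "Suc t"] t Suc by (auto simp: e_def h_def)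
  have he: "h \<le> \<alpha> * e" using eta_ratio[of "Suc t"] t Suc by (simp add: h_def e_def)
  have eL: "K * (e * L)\<^sup>2 \<le> 1 / 4" using eta_times_L(1)[of t] t Suc by (simp add: e_def)
  have dev_t: "dev t = deviation" by (simp add: dev_def Suc)
  define B where "B = \<beta> * dev s + 4 * (1 - \<beta>) * prefix_energy (\<pi> t)"
  have B: "0 \<le> B" using beta dev_nonneg[of s] s prefix_energy_nonneg by (simp add: B_def)
  have "dev t / (2 * L) - L / 2 * (e\<^sup>2 * (B + (1 - \<beta>) * (4 / 3 * dev t)))
      \<le> dev t / (2 * L) - L / 2 * (e\<^sup>2 * (\<beta> * (norm (momentum s))\<^sup>2 + (1 - \<beta>) * (4 / 3 * dev t)
          + 4 * (1 - \<beta>) * prefix_energy (\<pi> t)))"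
    using momentum_le_dev[of s] s beta L_pos
    by (intro diff_left_mono mult_left_mono) (auto simp: B_def mult_left_mono)
  also have "\<dots> \<le> m \<bullet> (w n - wstar)"
    using inner_m_end_ge by (simp add: dev_t e_def)
  also have "\<dots> = momentum t \<bullet> (W t - wstar)"
    using s by (simp add: Suc momentum_Suc W_Suc)
  finally have "2 * h * \<beta> * (dev t / (2 * L) - L / 2 * (e\<^sup>2 * (B + (1 - \<beta>) * (4 / 3 * dev t))))
      \<le> 2 * h * \<beta> * (momentum t \<bullet> (W t - wstar))"
    using h beta by (intro mult_left_mono) auto
  moreover have "2 * h * \<beta> * (dev t / (2 * L) - L / 2 * (e\<^sup>2 * (B + (1 - \<beta>) * (4 / 3 * dev t))))
      = h * \<beta> * dev t / L - h * \<beta> * L * e\<^sup>2 * B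
        - (h * \<beta> * (1 - \<beta>) * dev t / L * (4 / 3)) * (e * L)\<^sup>2"
    using L_pos by (simp add: field_simps power2_eq_square)
  moreover have "h * \<beta> * L * e\<^sup>2 * B \<le> carry t"
  proof -
    have "h * (\<beta> * L * e\<^sup>2 * B) \<le> \<alpha> * e * (\<beta> * L * e\<^sup>2 * B)"
      using he B beta L_pos by (intro mult_right_mono) auto
    then show ?thesis
      by (simp add: carry_def Suc B_def e_def power2_eq_square power3_eq_cube algebra_simps)
  qed
  moreover have "(h * \<beta> * (1 - \<beta>) * dev t / L * (4 / 3)) * (e * L)\<^sup>2
      \<le> (h * \<beta> * (1 - \<beta>) * dev t / L * (4 / 3)) * (1 / (4 * K))"
  proof (rule mult_left_mono)
    show "(e * L)\<^sup>2 \<le> 1 / (4 * K)" using eL K_ge_1 by (simp add: field_simps)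
    show "0 \<le> h * \<beta> * (1 - \<beta>) * dev t / L * (4 / 3)"
      using h beta dev_nonneg[of t] t L_pos by simp
  qed
  moreover have "(h * \<beta> * (1 - \<beta>) * dev t / L * (4 / 3)) * (1 / (4 * K))
      = h * \<beta> * (1 - \<beta>) * dev t / (3 * K * L)"
    by simp (simp add: mult_ac)
  ultimately show ?thesis unfolding h_def[symmetric] by linarith
qed

lemma potential_decrease:
  assumes t: "t < T"
  shows "potential (Suc t) + 2 * \<eta> (Suc t) * (1 - \<beta>) * gap (W t)
    \<le> potential t + 4 * K * L * (\<eta> (Suc t)) ^ 3 * prefix_energy (\<pi> (Suc t))"
proof -
  interpret smg_single_epoch n f L wstar \<beta> "\<eta> (Suc t)" "\<pi> (Suc t)" "W t" "momentum t"
    by (rule single_epoch[OF t])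
  define h where "h = \<eta> (Suc t)"
  define S where "S = prefix_energy (\<pi> (Suc t))"
  define y where "y = W t - wstar"
  have h: "0 < h" using eta_bound[of "Suc t"] t by (simp add: h_def)
  define u where "u = \<beta> *\<^sub>R momentum t + (1 - \<beta>) *\<^sub>R m"
  have "W (Suc t) - wstar = y - h *\<^sub>R u"
    using t end_point_eq by (simp add: W_Suc y_def h_def u_def)
  have "(norm (W (Suc t) - wstar))\<^sup>2
      = (norm y)\<^sup>2 - 2 * h * (\<beta> * (momentum t \<bullet> y) + (1 - \<beta>) * (m \<bullet> y)) + h\<^sup>2 * (norm u)\<^sup>2"
  proof -
    have "(norm (y - h *\<^sub>R u))\<^sup>2 = (norm y)\<^sup>2 - 2 * h * (u \<bullet> y) + h\<^sup>2 * (norm u)\<^sup>2"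
      unfolding power2_norm_eq_inner
      by (simp add: inner_diff_left inner_diff_right inner_commute[of y u] power2_eq_square
          algebra_simps)
    moreover have "u \<bullet> y = \<beta> * (momentum t \<bullet> y) + (1 - \<beta>) * (m \<bullet> y)"
      by (simp add: u_def inner_add_left)
    ultimately show ?thesis using \<open>W (Suc t) - wstar = y - h *\<^sub>R u\<close> by simp
  qed
  also have "(norm u)\<^sup>2 \<le> \<beta> * (norm (momentum t))\<^sup>2 + (1 - \<beta>) * (norm m)\<^sup>2"
    unfolding u_def using beta by (intro norm_convex_combination_squared) auto
  also have "\<dots> \<le> \<beta> * dev t + (1 - \<beta>) * deviation"
    using beta t by (intro add_mono mult_left_mono momentum_le_dev norm_m_squared_le) auto
  finally have dist: "(norm (W (Suc t) - wstar))\<^sup>2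
      \<le> (norm y)\<^sup>2 - 2 * h * (\<beta> * (momentum t \<bullet> y) + (1 - \<beta>) * (m \<bullet> y))
        + h\<^sup>2 * (\<beta> * dev t + (1 - \<beta>) * deviation)"
    by (simp add: mult_left_mono)
  have "(norm y)\<^sup>2 - 2 * h * (\<beta> * (momentum t \<bullet> y) + (1 - \<beta>) * (m \<bullet> y))
        + h\<^sup>2 * (\<beta> * dev t + (1 - \<beta>) * deviation)
        + (K - 1) * L * h ^ 3 * (\<beta> * dev t + 4 * (1 - \<beta>) * S) + 2 * h * (1 - \<beta>) * gap (W t)
      \<le> (norm y)\<^sup>2 + carry t + 4 * K * L * h ^ 3 * S"
  proof (rule epoch_arithmetic)
    show "- (2 * h * \<beta> * (momentum t \<bullet> y))
        \<le> carry t - h * \<beta> * dev t / L + h * \<beta> * (1 - \<beta>) * dev t / (3 * K * L)"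
      using stale_momentum_bound[OF t] by (simp add: h_def y_def)
    have "gap (W t) + deviation / (2 * L)
        - L / 2 * (h\<^sup>2 * ((\<beta> * dev t + (1 - \<beta>) * (4 / 3 * deviation)) / 2 + 4 * (1 - \<beta>) * S))
      \<le> gap (W t) + deviation / (2 * L)
        - L / 2 * (h\<^sup>2 * ((\<beta> * (norm (momentum t))\<^sup>2 + (1 - \<beta>) * (4 / 3 * deviation)) / 2 + 4 * (1 - \<beta>) * S))"
      using momentum_le_dev[of t] t beta L_pos
      by (intro diff_left_mono mult_left_mono) (auto simp: mult_left_mono)
    also have "\<dots> \<le> m \<bullet> y"
      unfolding h_def S_def y_def by (rule inner_m_start_ge)
    finally show "gap (W t) + deviation / (2 * L)
        - L / 2 * (h\<^sup>2 * ((\<beta> * dev t + (1 - \<beta>) * (4 / 3 * deviation)) / 2 + 4 * (1 - \<beta>) * S))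
      \<le> m \<bullet> y" .
  qed (use h L_pos K_ge_1 eta_times_L[of "Suc t"] t beta deviation_nonneg dev_nonneg
        prefix_energy_nonneg in \<open>auto simp: h_def S_def\<close>)
  moreover have "carry (Suc t) = (K - 1) * L * h ^ 3 * (\<beta> * dev t + 4 * (1 - \<beta>) * S)"
    by (simp add: carry_def K h_def S_def)
  ultimately show ?thesis
    using dist by (simp add: potential_def h_def S_def y_def)
qed

text \<open>
  The potential starts at the squared initial distance and stays nonnegative, so the telescoped sum of the gaps is
  paid by that distance and the prefix energies. No probability is involved yet.
\<close>

lemma weighted_gaps_le:
  "2 * (1 - \<beta>) * (\<Sum>t=1..T. \<eta> t * gap (W (t - 1)))
    \<le> (norm (x - wstar))\<^sup>2 + 4 * K * L * (\<Sum>t=1..T. (\<eta> t) ^ 3 * prefix_energy (\<pi> t))"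
proof -
  have "potential s + 2 * (1 - \<beta>) * (\<Sum>t=1..s. \<eta> t * gap (W (t - 1)))
      \<le> potential 0 + 4 * K * L * (\<Sum>t=1..s. (\<eta> t) ^ 3 * prefix_energy (\<pi> t))" if "s \<le> T" for s
    using that
  proof (induction s)
    case (Suc s)
    then show ?case using potential_decrease[of s] by (simp add: algebra_simps)
  qed simp
  from this[of T] have "potential T + 2 * (1 - \<beta>) * (\<Sum>t=1..T. \<eta> t * gap (W (t - 1)))
      \<le> potential 0 + 4 * K * L * (\<Sum>t=1..T. (\<eta> t) ^ 3 * prefix_energy (\<pi> t))" by simp
  moreover have "0 \<le> potential T" using carry_nonneg[of T] by (simp add: potential_def)
  moreover have "potential 0 = (norm (x - wstar))\<^sup>2"
    by (simp add: potential_def carry_def W_def smg_iterate_def)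
  ultimately show ?thesis by linarith
qed

end

section \<open>Partial sums in a uniformly random order\<close>

text \<open>
  Sampling without replacement. Composing with transpositions shows that the summed products \<open>C a b\<close> take one value
  on the diagonal and one off it. The diagonal value \<open>N\<close> follows by summing over the diagonal; each row of \<open>C\<close> sums to
  zero, hence the off-diagonal value is \<open>-N / (n - 1)\<close>. The equation is multiplied by \<open>n - 1\<close> so that it holds
  for \<open>n = 1\<close> too.
\<close>

lemma sum_permutations_prefix_norm_squared:
  fixes y :: "nat \<Rightarrow> 'a::real_inner"
  assumes zero: "(\<Sum>i=1..n. y i) = 0" and k: "k \<le> n"
  shows "(real n - 1) * (\<Sum>p | p permutes {1..n}. (norm (\<Sum>j<k. y (p (j + 1))))\<^sup>2)
    = real k * (real n - real k) * (fact n / n * (\<Sum>i=1..n. (norm (y i))\<^sup>2))"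
proof -
  define C where "C a b = (\<Sum>p | p permutes {1..n}. y (p a) \<bullet> y (p b))" for a b
  define N where "N = fact n / n * (\<Sum>i=1..n. (norm (y i))\<^sup>2)"
  have swap: "C a b = C (Transposition.transpose c d a) (Transposition.transpose c d b)" if "c \<in> {1..n}" "d \<in> {1..n}" for a b c d
    unfolding C_def
    by (subst sum_permutations_compose_right[OF permutes_swap_id[OF that]]) simp
  have diag: "C a a = N" if a: "a \<in> {1..n}" for a
  proof -
    have "(\<Sum>b=1..n. C b b) = (\<Sum>b=1..n. C a a)"
      using swap[OF a, of _ a a] by (intro sum.cong) auto
    then have "n * C a a = (\<Sum>b=1..n. C b b)"
      by simp
    also have "\<dots> = (\<Sum>p | p permutes {1..n}. \<Sum>b=1..n. (norm (y (p b)))\<^sup>2)"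
      unfolding C_def by (subst sum.swap) (simp add: power2_norm_eq_inner)
    also have "\<dots> = (\<Sum>p | p permutes {1..n}. \<Sum>b=1..n. (norm (y b))\<^sup>2)"
    proof (rule sum.cong[OF refl])
      fix p assume "p \<in> {p. p permutes {1..n}}"
      then have "p permutes {1..n}" by simp
      from sum.permute[OF this, of "\<lambda>b. (norm (y b))\<^sup>2"]
      show "(\<Sum>b=1..n. (norm (y (p b)))\<^sup>2) = (\<Sum>b=1..n. (norm (y b))\<^sup>2)" by (simp add: o_def)
    qed
    also have "\<dots> = fact n * (\<Sum>b=1..n. (norm (y b))\<^sup>2)"
      by (simp add: card_permutations)
    finally show ?thesis using a by (simp add: N_def field_simps)
  qed
  have off: "(real n - 1) * C a b = - N" if ab: "a \<in> {1..n}" "b \<in> {1..n}" "a \<noteq> b" for a b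
  proof -
    have "(\<Sum>c=1..n. C a c) = (\<Sum>p | p permutes {1..n}. y (p a) \<bullet> (\<Sum>c=1..n. y (p c)))"
      unfolding C_def by (subst sum.swap) (simp add: inner_sum_right)
    also have "\<dots> = 0"
    proof (rule sum.neutral, safe)
      fix p assume "p permutes {1..n}"
      from sum.permute[OF this, of y] show "y (p a) \<bullet> (\<Sum>c=1..n. y (p c)) = 0"
        using zero by (simp add: o_def)
    qed
    also have "(\<Sum>c=1..n. C a c) = C a a + (\<Sum>c\<in>{1..n} - {a}. C a c)"
      using ab by (subst sum.remove[of _ a]) auto
    also have "(\<Sum>c\<in>{1..n} - {a}. C a c) = (\<Sum>c\<in>{1..n} - {a}. C a b)"
    proof (rule sum.cong[OF refl])
      fix c assume "c \<in> {1..n} - {a}"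
      then show "C a c = C a b" using swap[of c b a c] ab by (simp add: Transposition.transpose_def)
    qed
    also have "\<dots> = (real n - 1) * C a b" using ab by (simp add: of_nat_diff)
    finally show ?thesis using diag ab by simp
  qed
  have "(\<Sum>p | p permutes {1..n}. (norm (\<Sum>j<k. y (p (j + 1))))\<^sup>2)
      = (\<Sum>i<k. \<Sum>j<k. C (i + 1) (j + 1))"
  proof -
    have "(\<Sum>p | p permutes {1..n}. (norm (\<Sum>j<k. y (p (j + 1))))\<^sup>2)
        = (\<Sum>p | p permutes {1..n}. \<Sum>i<k. \<Sum>j<k. y (p (i + 1)) \<bullet> y (p (j + 1)))"
      by (simp only: power2_norm_eq_inner inner_sum_left inner_sum_right) (intro sum.cong refl sum.swap)
    also have "\<dots> = (\<Sum>i<k. \<Sum>p | p permutes {1..n}. \<Sum>j<k. y (p (i + 1)) \<bullet> y (p (j + 1)))"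
      by (rule sum.swap)
    also have "\<dots> = (\<Sum>i<k. \<Sum>j<k. C (i + 1) (j + 1))"
      unfolding C_def by (intro sum.cong refl sum.swap)
    finally show ?thesis .
  qed
  then have "(real n - 1) * (\<Sum>p | p permutes {1..n}. (norm (\<Sum>j<k. y (p (j + 1))))\<^sup>2)
      = (\<Sum>i<k. \<Sum>j<k. (real n - 1) * C (i + 1) (j + 1))"
    by (simp add: sum_distrib_left)
  also have "\<dots> = (\<Sum>i<k. (real n - real k) * N)"
  proof (rule sum.cong[OF refl])
    fix i assume "i \<in> {..<k}"
    then have i: "i < k" by simp
    have "(\<Sum>j<k. (real n - 1) * C (i + 1) (j + 1))
        = (real n - 1) * C (i + 1) (i + 1) + (\<Sum>j\<in>{..<k} - {i}. (real n - 1) * C (i + 1) (j + 1))"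
      using i by (subst sum.remove[of _ i]) auto
    also have "(\<Sum>j\<in>{..<k} - {i}. (real n - 1) * C (i + 1) (j + 1)) = (\<Sum>j\<in>{..<k} - {i}. - N)"
      using i k by (intro sum.cong refl off) auto
    also have "\<dots> = - (real k - 1) * N" using i by (simp add: of_nat_diff algebra_simps)
    also have "C (i + 1) (i + 1) = N" using i k by (intro diag) auto
    finally show "(\<Sum>j<k. (real n - 1) * C (i + 1) (j + 1)) = (real n - real k) * N"
      by (simp add: algebra_simps)
  qed
  finally show ?thesis by (simp add: N_def)
qed

lemma sum_mult_complement:
  "(\<Sum>k<n. real k * (real n - real k)) = (real n - 1) * real n * (real n + 1) / 6"
proof -
  have s1: "(\<Sum>k<n. real k) = real n * (real n - 1) / 2" for n :: nat
    by (induction n) (auto simp: field_simps)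
  have s2: "(\<Sum>k<n. (real k)\<^sup>2) = (real n - 1) * real n * (2 * real n - 1) / 6" for n :: nat
    by (induction n) (auto simp: field_simps power2_eq_square)
  have "(\<Sum>k<n. real k * (real n - real k)) = real n * (\<Sum>k<n. real k) - (\<Sum>k<n. (real k)\<^sup>2)"
    by (simp add: algebra_simps sum_subtractf sum_distrib_left power2_eq_square)
  then show ?thesis by (simp add: s1 s2 field_simps)
qed

text \<open>
  The exact value is \<open>(n + 1) / (6 n\<^sup>2)\<close> times the mean of the \<open>\<parallel>y i\<parallel>\<^sup>2\<close> when \<open>n > 1\<close>; the bound uses \<open>n + 1 \<le> 2 n\<close>. For
  \<open>n = 1\<close> the only partial sum is empty.
\<close>

lemma average_prefix_energy_le:
  fixes y :: "nat \<Rightarrow> 'a::real_inner"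
  assumes zero: "(\<Sum>i=1..n. y i) = 0" and n: "1 \<le> n"
  shows "(\<Sum>p | p permutes {1..n}. (\<Sum>k<n. (norm (\<Sum>j<k. y (p (j + 1))))\<^sup>2) / n ^ 3) / fact n
    \<le> ((1 / n) * (\<Sum>i=1..n. (norm (y i))\<^sup>2)) / (3 * n)"
proof (cases "n = 1")
  case True
  then show ?thesis by simp
next
  case False
  with n have n2: "real n - 1 > 0" by simp
  define N where "N = (1 / n) * (\<Sum>i=1..n. (norm (y i))\<^sup>2)"
  define E where "E = (\<Sum>k<n. \<Sum>p | p permutes {1..n}. (norm (\<Sum>j<k. y (p (j + 1))))\<^sup>2)"
  have N: "0 \<le> N" by (simp add: N_def sum_nonneg)
  have "(real n - 1) * E = (\<Sum>k<n. real k * (real n - real k) * (fact n * N))"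
    unfolding E_def sum_distrib_left
  proof (rule sum.cong[OF refl])
    fix k assume "k \<in> {..<n}"
    then show "(\<Sum>p | p permutes {1..n}. (real n - 1) * (norm (\<Sum>j<k. y (p (j + 1))))\<^sup>2)
        = real k * (real n - real k) * (fact n * N)"
      using sum_permutations_prefix_norm_squared[OF zero, of k]
      by (simp add: sum_distrib_left N_def)
  qed
  also have "\<dots> = (real n - 1) * (real n * (real n + 1) / 6 * (fact n * N))"
    by (simp add: sum_distrib_right[symmetric] sum_mult_complement)
  finally have E: "E = real n * (real n + 1) / 6 * (fact n * N)"
    using n2 by simp
  have "(\<Sum>p | p permutes {1..n}. (\<Sum>k<n. (norm (\<Sum>j<k. y (p (j + 1))))\<^sup>2) / n ^ 3) / fact n
      = E / n ^ 3 / fact n"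
    unfolding E_def by (subst sum.swap) (simp add: sum_divide_distrib)
  also have "\<dots> = (real n + 1) / (6 * (real n)\<^sup>2) * N"
    using n by (simp add: E field_simps power2_eq_square power3_eq_cube)
  also have "\<dots> \<le> (1 / (3 * n)) * N"
    using n by (intro mult_right_mono N) (simp add: field_simps power2_eq_square)
  finally show ?thesis by (simp add: N_def)
qed

lemma finite_permutations_upto: "finite {p. p permutes {1..n::nat}}"
  by (rule finite_permutations) simp

lemma uniform_permutation_integral:
  fixes \<phi> :: "(nat \<Rightarrow> nat) \<Rightarrow> real"
  assumes P: "P \<in> measurable M (perm_space n)"
    and uniform: "distr M (perm_space n) P = uniform_count_measure {p. p permutes {1..n}}"
  shows uniform_permutation_integrable: "integrable M (\<lambda>\<omega>. \<phi> (P \<omega>))"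
    and uniform_permutation_expectation:
      "(\<integral>\<omega>. \<phi> (P \<omega>) \<partial>M) = (\<Sum>p | p permutes {1..n}. \<phi> p) / fact n"
proof -
  have \<phi>: "\<phi> \<in> borel_measurable (perm_space n)" by (simp add: perm_space_def)
  have "integrable (distr M (perm_space n) P) \<phi>"
    unfolding uniform uniform_count_measure_def
    by (rule integrable_point_measure_finite) (rule finite_permutations_upto)
  then show "integrable M (\<lambda>\<omega>. \<phi> (P \<omega>))"
    by (simp add: integrable_distr_eq[OF P \<phi>])
  show "(\<integral>\<omega>. \<phi> (P \<omega>) \<partial>M) = (\<Sum>p | p permutes {1..n}. \<phi> p) / fact n"
    unfolding integral_distr[OF P \<phi>, symmetric] uniform
    by (simp only: integral_uniform_count_measure[OF finite_permutations_upto]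
        card_permutations[OF refl finite_atLeastAtMost] card_atLeastAtMost diff_Suc_1 of_nat_fact)
qed

section \<open>Measurability of the iterates\<close>

lemma borel_measurable_gradient:
  assumes "L_smooth L f" and "0 < L"
  shows "gradient f \<in> borel_measurable borel"
proof -
  have "L-lipschitz_on UNIV (gradient f)"
    using assms by (intro lipschitz_onI) (auto simp: L_smooth_def dist_norm)
  then show ?thesis
    by (intro borel_measurable_continuous_onI lipschitz_on_continuous_on)
qed

lemma borel_measurable_L_smooth:
  assumes "L_smooth L f"
  shows "f \<in> borel_measurable borel"
  using assms
  by (intro borel_measurable_continuous_onI continuous_at_imp_continuous_on ballI
      differentiable_imp_continuous_within) (simp add: L_smooth_def)

lemma borel_measurable_smg_inner:
  fixes f :: "nat \<Rightarrow> 'a::euclidean_space \<Rightarrow> real"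
  assumes grad: "\<And>i. i \<in> {1..n} \<Longrightarrow> gradient (f i) \<in> borel_measurable borel"
    and p: "p permutes {1..n}"
    and [measurable]: "w0 \<in> borel_measurable N" "m0 \<in> borel_measurable N"
  shows borel_measurable_smg_inner_point:
      "(\<lambda>\<omega>. fst (smg_inner n f \<beta> h p (w0 \<omega>) (m0 \<omega>) n)) \<in> borel_measurable N"
    and borel_measurable_smg_inner_average:
      "(\<lambda>\<omega>. snd (snd (smg_inner n f \<beta> h p (w0 \<omega>) (m0 \<omega>) n))) \<in> borel_measurable N"
proof -
  have g: "(\<lambda>\<omega>. gradient (f (p (j + 1))) (fst (smg_inner n f \<beta> h p (w0 \<omega>) (m0 \<omega>) j)))
      \<in> borel_measurable N"
    if "(\<lambda>\<omega>. fst (smg_inner n f \<beta> h p (w0 \<omega>) (m0 \<omega>) j)) \<in> borel_measurable N" "j < n" for j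
  proof (rule measurable_compose[OF that(1) grad])
    show "p (j + 1) \<in> {1..n}" using that(2) by (subst permutes_in_image[OF p]) simp
  qed
  have w: "(\<lambda>\<omega>. fst (smg_inner n f \<beta> h p (w0 \<omega>) (m0 \<omega>) i)) \<in> borel_measurable N" if "i \<le> n" for i
    using that
  proof (induction i rule: less_induct)
    case (less i)
    have [measurable]: "(\<lambda>\<omega>. \<Sum>j<i. gradient (f (p (j + 1)))
        (fst (smg_inner n f \<beta> h p (w0 \<omega>) (m0 \<omega>) j))) \<in> borel_measurable N"
      using less by (intro borel_measurable_sum g) auto
    show ?case by (subst smg_inner_point) measurable
  qed
  then show "(\<lambda>\<omega>. fst (smg_inner n f \<beta> h p (w0 \<omega>) (m0 \<omega>) n)) \<in> borel_measurable N" by simp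
  have [measurable]: "(\<lambda>\<omega>. \<Sum>j<n. gradient (f (p (j + 1)))
      (fst (smg_inner n f \<beta> h p (w0 \<omega>) (m0 \<omega>) j))) \<in> borel_measurable N"
    using w by (intro borel_measurable_sum g) auto
  show "(\<lambda>\<omega>. snd (snd (smg_inner n f \<beta> h p (w0 \<omega>) (m0 \<omega>) n))) \<in> borel_measurable N"
    by (subst smg_inner_average) measurable
qed

text \<open>
  The permutations enter through indices of gradients, so no continuity is available in them; but they take finitely
  many values, and for each fixed value the epoch is a composition of measurable maps.
\<close>

lemma borel_measurable_smg_epoch:
  fixes f :: "nat \<Rightarrow> 'a::euclidean_space \<Rightarrow> real"
  assumes grad: "\<And>i. i \<in> {1..n} \<Longrightarrow> gradient (f i) \<in> borel_measurable borel"
    and X: "X \<in> borel_measurable N"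
    and P: "\<And>s. s \<in> {1..t} \<Longrightarrow> P s \<in> measurable N (perm_space n)"
  shows "(\<lambda>\<omega>. fst (smg_epoch n f \<beta> \<eta> (\<lambda>s. P s \<omega>) (X \<omega>) t)) \<in> borel_measurable N
    \<and> (\<lambda>\<omega>. snd (smg_epoch n f \<beta> \<eta> (\<lambda>s. P s \<omega>) (X \<omega>) t)) \<in> borel_measurable N"
  using P
proof (induction t)
  case 0
  then show ?case using X by simp
next
  case (Suc t)
  then have IH: "(\<lambda>\<omega>. fst (smg_epoch n f \<beta> \<eta> (\<lambda>s. P s \<omega>) (X \<omega>) t)) \<in> borel_measurable N"
    "(\<lambda>\<omega>. snd (smg_epoch n f \<beta> \<eta> (\<lambda>s. P s \<omega>) (X \<omega>) t)) \<in> borel_measurable N" by auto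
  have P': "P (Suc t) \<in> measurable N (count_space {p. p permutes {1..n}})"
    using Suc.prems[of "Suc t"] by (simp add: perm_space_def)
  have "(\<lambda>\<omega>. fst (smg_inner n f \<beta> (\<eta> (Suc t)) (P (Suc t) \<omega>)
        (fst (smg_epoch n f \<beta> \<eta> (\<lambda>s. P s \<omega>) (X \<omega>) t))
        (snd (smg_epoch n f \<beta> \<eta> (\<lambda>s. P s \<omega>) (X \<omega>) t)) n)) \<in> borel_measurable N"
    by (rule measurable_compose_countable'[OF _ P' countable_finite[OF finite_permutations_upto]])
      (use IH in \<open>auto intro!: borel_measurable_smg_inner_point grad\<close>)
  moreover have "(\<lambda>\<omega>. snd (snd (smg_inner n f \<beta> (\<eta> (Suc t)) (P (Suc t) \<omega>)
        (fst (smg_epoch n f \<beta> \<eta> (\<lambda>s. P s \<omega>) (X \<omega>) t))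
        (snd (smg_epoch n f \<beta> \<eta> (\<lambda>s. P s \<omega>) (X \<omega>) t)) n))) \<in> borel_measurable N"
    by (rule measurable_compose_countable'[OF _ P' countable_finite[OF finite_permutations_upto]])
      (use IH in \<open>auto intro!: borel_measurable_smg_inner_average grad\<close>)
  ultimately show ?case by (simp add: case_prod_beta)
qed

lemma smg_epoch_cong:
  assumes "\<And>s. s \<in> {1..t} \<Longrightarrow> \<pi> s = \<pi>' s"
  shows "smg_epoch n f \<beta> \<eta> \<pi> x t = smg_epoch n f \<beta> \<eta> \<pi>' x t"
  using assms by (induction t) (auto simp: case_prod_beta)

section \<open>Selection by an independent index\<close>

text \<open>
  A function of \<open>X\<close> generates no more events than \<open>X\<close> itself.
\<close>

lemma sigma_sets_compose_subset:
  assumes X: "X \<in> measurable M N" and h: "h \<in> measurable N N'"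
  shows "sigma_sets (space M) {(\<lambda>\<omega>. h (X \<omega>)) -` A \<inter> space M | A. A \<in> sets N'}
    \<subseteq> {X -` A \<inter> space M | A. A \<in> sets N}"
proof -
  let ?V = "vimage_algebra (space M) X N"
  have V: "sets ?V = {X -` A \<inter> space M | A. A \<in> sets N}"
    using X by (intro sets_vimage_algebra2) (auto dest: measurable_space)
  have "{(\<lambda>\<omega>. h (X \<omega>)) -` A \<inter> space M | A. A \<in> sets N'} \<subseteq> sets ?V"
  proof safe
    fix A assume "A \<in> sets N'"
    then have "h -` A \<inter> space N \<in> sets N" using h by (rule measurable_sets[rotated])
    moreover have "(\<lambda>\<omega>. h (X \<omega>)) -` A \<inter> space M = X -` (h -` A \<inter> space N) \<inter> space M"
      using X by (auto dest: measurable_space)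
    ultimately show "(\<lambda>\<omega>. h (X \<omega>)) -` A \<inter> space M \<in> sets ?V" unfolding V by blast
  qed
  from sets.sigma_sets_subset[OF this] show ?thesis by (simp add: V)
qed

text \<open>
  Functions with a common codomain of two independent variables fall under the library's \<^const>\<open>prob_space.indep_var\<close>, which gives
  access to the product rule for expectations.
\<close>

lemma (in prob_space) indep_rv_compose:
  fixes h :: "'c \<Rightarrow> 'e" and k :: "'d \<Rightarrow> 'e"
  assumes "indep_rv M N X N' Y" and h: "h \<in> measurable N S" and k: "k \<in> measurable N' S'"
  shows "indep_var S (\<lambda>\<omega>. h (X \<omega>)) S' (\<lambda>\<omega>. k (Y \<omega>))"
proof -
  have X: "X \<in> measurable M N" and Y: "Y \<in> measurable M N'"
    and indep: "indep_set {X -` A \<inter> space M | A. A \<in> sets N} {Y -` B \<inter> space M | B. B \<in> sets N'}"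
    using assms(1) by (auto simp: indep_rv_def)
  have "indep_set (sigma_sets (space M) {(\<lambda>\<omega>. h (X \<omega>)) -` A \<inter> space M | A. A \<in> sets S})
      (sigma_sets (space M) {(\<lambda>\<omega>. k (Y \<omega>)) -` A \<inter> space M | A. A \<in> sets S'})"
    using indep sigma_sets_compose_subset[OF X h] sigma_sets_compose_subset[OF Y k]
    unfolding indep_set_def
    by (elim indep_sets_mono_sets) (auto split: bool.split)
  then show ?thesis
    using measurable_compose[OF X h] measurable_compose[OF Y k] by (simp add: indep_var_eq)
qed

text \<open>
  Selecting a real random quantity on the event \<open>\<tau> = t\<close>: the indicator of the event is independent of the quantity.
\<close>

lemma (in prob_space) indep_selection:
  fixes h :: "'c \<Rightarrow> real"
  assumes indep: "indep_rv M N X (count_space I) \<tau>"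
    and h: "h \<in> borel_measurable N" and int: "integrable M (\<lambda>\<omega>. h (X \<omega>))"
  shows integrable_indep_selection: "integrable M (\<lambda>\<omega>. h (X \<omega>) * indicator {t} (\<tau> \<omega>))"
    and expectation_indep_selection: "expectation (\<lambda>\<omega>. h (X \<omega>) * indicator {t} (\<tau> \<omega>))
      = expectation (\<lambda>\<omega>. h (X \<omega>)) * prob {\<omega> \<in> space M. \<tau> \<omega> = t}"
proof -
  have \<tau>: "\<tau> \<in> measurable M (count_space I)" using indep by (simp add: indep_rv_def)
  have k: "(indicator {t} :: _ \<Rightarrow> real) \<in> borel_measurable (count_space I)" by simp
  have var: "indep_var borel (\<lambda>\<omega>. h (X \<omega>)) borel (\<lambda>\<omega>. indicator {t} (\<tau> \<omega>) :: real)"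
    using indep h k by (rule indep_rv_compose)
  have "AE \<omega> in M. norm (indicator {t} (\<tau> \<omega>) :: real) \<le> 1"
    by (auto simp: indicator_def)
  then have ind: "integrable M (\<lambda>\<omega>. indicator {t} (\<tau> \<omega>) :: real)"
    by (rule integrable_const_bound) (rule measurable_compose[OF \<tau> k])
  show "integrable M (\<lambda>\<omega>. h (X \<omega>) * indicator {t} (\<tau> \<omega>))"
    using var int ind by (rule indep_var_integrable)
  have "{\<omega> \<in> space M. \<tau> \<omega> = t} = \<tau> -` ({t} \<inter> I) \<inter> space M"
    using measurable_space[OF \<tau>] by auto
  then have "{\<omega> \<in> space M. \<tau> \<omega> = t} \<in> events"
    using measurable_sets[OF \<tau>, of "{t} \<inter> I"] by simp
  moreover have "expectation (\<lambda>\<omega>. indicator {t} (\<tau> \<omega>) :: real)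
      = expectation (indicator {\<omega> \<in> space M. \<tau> \<omega> = t})"
    by (intro Bochner_Integration.integral_cong) (auto simp: indicator_def)
  ultimately have "expectation (\<lambda>\<omega>. indicator {t} (\<tau> \<omega>) :: real) = prob {\<omega> \<in> space M. \<tau> \<omega> = t}"
    by simp
  with indep_var_lebesgue_integral[OF var int ind]
  show "expectation (\<lambda>\<omega>. h (X \<omega>) * indicator {t} (\<tau> \<omega>))
      = expectation (\<lambda>\<omega>. h (X \<omega>)) * prob {\<omega> \<in> space M. \<tau> \<omega> = t}"
    by simp
qed

section \<open>The convergence rate\<close>

theorem theorem1:
  fixes M :: "'b measure"
    and f :: "nat \<Rightarrow> 'a::euclidean_space \<Rightarrow> real"
    and n T :: nat
    and L \<sigma> \<alpha> \<beta> K :: real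
    and \<eta> :: "nat \<Rightarrow> real"
    and F :: "'a \<Rightarrow> real"
    and wstar :: 'a
    and W0 what :: "'b \<Rightarrow> 'a"
    and \<pi> :: "nat \<Rightarrow> 'b \<Rightarrow> nat \<Rightarrow> nat"
    and \<tau> :: "'b \<Rightarrow> nat"
  assumes "n \<ge> 1" and "T \<ge> 1"
    and "L > 0"
    and convex: "\<And>i. i \<in> {1..n} \<Longrightarrow> convex_on UNIV (f i)"
    and smooth: "\<And>i. i \<in> {1..n} \<Longrightarrow> L_smooth L (f i)"
    and F: "F = finite_sum_objective n f"
    and minimizer: "\<And>w. F wstar \<le> F w"
    and sigma: "\<sigma>\<^sup>2 = (1 / real n) * (\<Sum>i=1..n. (norm (gradient (f i) wstar))\<^sup>2)"
    and "0 \<le> \<beta>" and "\<beta> < 1"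
    and "\<alpha> > 0"
    and K: "K = 1 + \<alpha> * \<beta>"
    and eta_ratio: "\<And>t. t \<in> {2..T} \<Longrightarrow> \<eta> t \<le> \<alpha> * \<eta> (t - 1)"
    and eta_bound: "\<And>t. t \<in> {1..T} \<Longrightarrow> 0 < \<eta> t \<and> \<eta> t \<le> 1 / (2 * L * sqrt K)"
    and "prob_space M"
    and init: "integrable M (\<lambda>\<omega>. (norm (W0 \<omega> - wstar))\<^sup>2)"
    and reshuffling: "randomized_reshuffling M n T W0 \<pi>"
    and output_epoch: "random_output_epoch M n T \<eta> W0 \<pi> \<tau>"
    and what: "\<And>\<omega>. \<omega> \<in> space M \<Longrightarrow>
      what \<omega> = smg_iterate n f \<beta> \<eta> (\<lambda>t. \<pi> t \<omega>) (W0 \<omega>) (\<tau> \<omega> - 1)"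
  shows "integrable M (\<lambda>\<omega>. F (what \<omega>) - F wstar) \<and>
    (\<integral>\<omega>. F (what \<omega>) - F wstar \<partial>M)
      \<le> (\<integral>\<omega>. (norm (W0 \<omega> - wstar))\<^sup>2 \<partial>M) / (2 * (1 - \<beta>) * (\<Sum>t=1..T. \<eta> t))
        + (4 * L * \<sigma>\<^sup>2 * (1 + \<alpha> * \<beta>)) / (6 * real n * (1 - \<beta>))
          * ((\<Sum>t=1..T. (\<eta> t)^3) / (\<Sum>t=1..T. \<eta> t))"
proof -
  interpret prob_space M by fact
  interpret problem: smooth_convex_sum n f L wstar
    using \<open>n \<ge> 1\<close> \<open>L > 0\<close> convex smooth minimizer by unfold_locales (auto simp: F)
  have gap_eq: "F w - F wstar = problem.gap w" for w by (simp add: F problem.gap_def)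

  have perm_meas: "\<pi> t \<in> measurable M (perm_space n)" if "t \<in> {1..T}" for t
    using reshuffling that unfolding randomized_reshuffling_def indep_vars_def by blast
  have perm_unif: "distr M (perm_space n) (\<pi> t) = uniform_count_measure {p. p permutes {1..n}}"
    if "t \<in> {1..T}" for t
    using reshuffling that unfolding randomized_reshuffling_def by blast
  have W0_meas: "W0 \<in> borel_measurable M"
    using reshuffling unfolding randomized_reshuffling_def indep_rv_def by blast
  have \<tau>_indep: "indep_rv M (borel \<Otimes>\<^sub>M perms_space n T) (\<lambda>\<omega>. (W0 \<omega>, \<lambda>t\<in>{1..T}. \<pi> t \<omega>))
      (count_space {1..T}) \<tau>"
    and \<tau>_prob: "\<And>t. t \<in> {1..T} \<Longrightarrow> prob {\<omega> \<in> space M. \<tau> \<omega> = t} = \<eta> t / (\<Sum>s=1..T. \<eta> s)"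
    using output_epoch unfolding random_output_epoch_def by blast+
  have \<tau>_range: "\<tau> \<omega> \<in> {1..T}" if "\<omega> \<in> space M" for \<omega>
    using \<tau>_indep that measurable_space[of \<tau> M "count_space {1..T}"] by (simp add: indep_rv_def)

  define e where "e t \<omega> = problem.gap (smg_iterate n f \<beta> \<eta> (\<lambda>t. \<pi> t \<omega>) (W0 \<omega>) (t - 1))" for t \<omega>
  define E where "E t \<omega> = problem.prefix_energy (\<pi> t \<omega>)" for t \<omega>
  define D where "D \<omega> = (norm (W0 \<omega> - wstar))\<^sup>2" for \<omega>
  define H where "H = (\<Sum>t=1..T. \<eta> t)"
  define Q where "Q = (\<Sum>t=1..T. (\<eta> t) ^ 3)"

  have grad: "gradient (f i) \<in> borel_measurable borel" if "i \<in> {1..n}" for i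
    using smooth[OF that] \<open>L > 0\<close> by (rule borel_measurable_gradient)
  have f_meas: "f i \<in> borel_measurable borel" if "i \<in> {1..n}" for i
    using smooth[OF that] by (rule borel_measurable_L_smooth)
  have gap_meas: "problem.gap \<in> borel_measurable borel"
    unfolding problem.gap_def[abs_def] finite_sum_objective_def
    by (intro borel_measurable_diff borel_measurable_times borel_measurable_sum
        borel_measurable_const f_meas)
  have e_meas: "e t \<in> borel_measurable M" if "t \<in> {1..T}" for t
  proof -
    have "(\<lambda>\<omega>. smg_iterate n f \<beta> \<eta> (\<lambda>t. \<pi> t \<omega>) (W0 \<omega>) (t - 1)) \<in> borel_measurable M"
      unfolding smg_iterate_def
      using that by (intro conjunct1[OF borel_measurable_smg_epoch] grad W0_meas perm_meas) auto
    then show ?thesis unfolding e_def[abs_def] by (rule measurable_compose[OF _ gap_meas])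
  qed

  have pathwise: "2 * (1 - \<beta>) * (\<Sum>t=1..T. \<eta> t * e t \<omega>) \<le> D \<omega> + 4 * K * L * (\<Sum>t=1..T. (\<eta> t) ^ 3 * E t \<omega>)"
    if "\<omega> \<in> space M" for \<omega>
  proof -
    have "\<pi> t \<omega> permutes {1..n}" if "t \<in> {1..T}" for t
      using measurable_space[OF perm_meas[OF that] \<open>\<omega> \<in> space M\<close>] by (simp add: perm_space_def)
    then interpret smg_run n f L wstar \<alpha> \<beta> K \<eta> T "\<lambda>t. \<pi> t \<omega>" "W0 \<omega>"
      using \<open>0 \<le> \<beta>\<close> \<open>\<beta> < 1\<close> \<open>\<alpha> > 0\<close> K eta_ratio eta_bound by unfold_locales auto
    show ?thesis using weighted_gaps_le by (simp add: W_def e_def D_def E_def)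
  qed

  have e_nonneg: "0 \<le> e t \<omega>" for t \<omega> by (simp add: e_def problem.gap_nonneg)
  have E_int: "integrable M (E t)" if "t \<in> {1..T}" for t
    unfolding E_def[abs_def] by (rule uniform_permutation_integrable[OF perm_meas[OF that] perm_unif[OF that]])
  have E_le: "expectation (E t) \<le> \<sigma>\<^sup>2 / (3 * n)" if "t \<in> {1..T}" for t
    unfolding E_def[abs_def] uniform_permutation_expectation[OF perm_meas[OF that] perm_unif[OF that]]
    unfolding problem.prefix_energy_def sigma
    using average_prefix_energy_le[OF problem.sum_gradient_minimizer \<open>n \<ge> 1\<close>] by simp
  have D_int: "integrable M D" using init by (simp add: D_def[abs_def])
  have bound_int: "integrable M (\<lambda>\<omega>. D \<omega> + 4 * K * L * (\<Sum>t=1..T. (\<eta> t) ^ 3 * E t \<omega>))"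
    using D_int E_int
    by (intro Bochner_Integration.integrable_add integrable_mult_right
        Bochner_Integration.integrable_sum) auto
  have eta_pos: "0 < \<eta> t" if "t \<in> {1..T}" for t using eta_bound[OF that] by simp

  \<comment> \<open>as all gaps are nonnegative, each one is dominated by a multiple of the integrable right-hand side of the pathwise bound\<close>
  have e_int: "integrable M (e t)" if t: "t \<in> {1..T}" for t
  proof (rule Bochner_Integration.integrable_bound)
    let ?c = "2 * (1 - \<beta>) * \<eta> t"
    show "integrable M (\<lambda>\<omega>. (D \<omega> + 4 * K * L * (\<Sum>t=1..T. (\<eta> t) ^ 3 * E t \<omega>)) / ?c)"
      using bound_int by simp
    show "AE \<omega> in M. norm (e t \<omega>) \<le> norm ((D \<omega> + 4 * K * L * (\<Sum>t=1..T. (\<eta> t) ^ 3 * E t \<omega>)) / ?c)"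
    proof (rule AE_I2)
      fix \<omega> assume \<omega>: "\<omega> \<in> space M"
      have "\<eta> t * e t \<omega> \<le> (\<Sum>t=1..T. \<eta> t * e t \<omega>)"
        using t eta_pos e_nonneg by (intro member_le_sum) (auto simp: less_imp_le)
      then have "2 * (1 - \<beta>) * (\<eta> t * e t \<omega>) \<le> 2 * (1 - \<beta>) * (\<Sum>t=1..T. \<eta> t * e t \<omega>)"
        using \<open>\<beta> < 1\<close> by (intro mult_left_mono) auto
      also note pathwise[OF \<omega>]
      finally have "e t \<omega> * ?c \<le> D \<omega> + 4 * K * L * (\<Sum>t=1..T. (\<eta> t) ^ 3 * E t \<omega>)"
        by (simp add: mult_ac)
      moreover have "0 < ?c" using eta_pos[OF t] \<open>\<beta> < 1\<close> by simp
      ultimately have "e t \<omega> \<le> (D \<omega> + 4 * K * L * (\<Sum>t=1..T. (\<eta> t) ^ 3 * E t \<omega>)) / ?c"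
        by (simp only: pos_le_divide_eq)
      then show "norm (e t \<omega>) \<le> norm ((D \<omega> + 4 * K * L * (\<Sum>t=1..T. (\<eta> t) ^ 3 * E t \<omega>)) / ?c)"
        unfolding real_norm_def abs_of_nonneg[OF e_nonneg] by (rule order.trans[OF _ abs_ge_self])
    qed
  qed (rule e_meas[OF t])

  have averaged: "2 * (1 - \<beta>) * (\<Sum>t=1..T. \<eta> t * expectation (e t))
      \<le> expectation D + 4 * K * L * (Q * (\<sigma>\<^sup>2 / (3 * n)))"
  proof -
    have "2 * (1 - \<beta>) * (\<Sum>t=1..T. \<eta> t * expectation (e t))
        = expectation (\<lambda>\<omega>. 2 * (1 - \<beta>) * (\<Sum>t=1..T. \<eta> t * e t \<omega>))"
      using e_int by (simp add: Bochner_Integration.integral_sum)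
    also have "\<dots> \<le> expectation (\<lambda>\<omega>. D \<omega> + 4 * K * L * (\<Sum>t=1..T. (\<eta> t) ^ 3 * E t \<omega>))"
      using e_int bound_int pathwise by (intro integral_mono) auto
    also have "\<dots> = expectation D + 4 * K * L * (\<Sum>t=1..T. (\<eta> t) ^ 3 * expectation (E t))"
    proof -
      have "expectation (\<lambda>\<omega>. \<Sum>t=1..T. (\<eta> t) ^ 3 * E t \<omega>)
          = (\<Sum>t=1..T. (\<eta> t) ^ 3 * expectation (E t))"
        using E_int by (subst Bochner_Integration.integral_sum) auto
      moreover have "integrable M (\<lambda>\<omega>. \<Sum>t=1..T. (\<eta> t) ^ 3 * E t \<omega>)"
        using E_int by (intro Bochner_Integration.integrable_sum integrable_mult_right) auto
      ultimately show ?thesis using D_int by simp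
    qed
    also have "\<dots> \<le> expectation D + 4 * K * L * (\<Sum>t=1..T. (\<eta> t) ^ 3 * (\<sigma>\<^sup>2 / (3 * n)))"
      using E_le eta_pos \<open>L > 0\<close> \<open>\<alpha> > 0\<close> \<open>0 \<le> \<beta>\<close>
      by (intro add_left_mono mult_left_mono sum_mono) (auto simp: K less_imp_le)
    also have "(\<Sum>t=1..T. (\<eta> t) ^ 3 * (\<sigma>\<^sup>2 / (3 * n))) = Q * (\<sigma>\<^sup>2 / (3 * n))"
      unfolding Q_def by (rule sum_distrib_right[symmetric])
    finally show ?thesis .
  qed

  have selected: "integrable M (\<lambda>\<omega>. e t \<omega> * indicator {t} (\<tau> \<omega>))
      \<and> expectation (\<lambda>\<omega>. e t \<omega> * indicator {t} (\<tau> \<omega>)) = expectation (e t) * (\<eta> t / H)"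
    if t: "t \<in> {1..T}" for t
  proof -
    define h where "h z = problem.gap (smg_iterate n f \<beta> \<eta> (snd z) (fst z) (t - 1))"
      for z :: "'a \<times> (nat \<Rightarrow> nat \<Rightarrow> nat)"
    have "(\<lambda>z. smg_iterate n f \<beta> \<eta> (snd z) (fst z) (t - 1))
        \<in> borel_measurable (borel \<Otimes>\<^sub>M perms_space n T)"
      unfolding smg_iterate_def
      using t by (intro conjunct1[OF borel_measurable_smg_epoch[where P = "\<lambda>s z. snd z s"]] grad
          measurable_fst measurable_compose[OF measurable_snd measurable_component_singleton]) auto
    then have h: "h \<in> borel_measurable (borel \<Otimes>\<^sub>M perms_space n T)"
      unfolding h_def[abs_def] by (rule measurable_compose[OF _ gap_meas])
    \<comment> \<open>the gap before epoch \<open>t\<close> only reads permutations of earlier epochs, so restricting the family to \<open>{1..T}\<close> loses nothing\<close>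
    have eh: "e t = (\<lambda>\<omega>. h (W0 \<omega>, \<lambda>s\<in>{1..T}. \<pi> s \<omega>))"
    proof
      fix \<omega>
      have "smg_epoch n f \<beta> \<eta> (\<lambda>s. \<pi> s \<omega>) (W0 \<omega>) (t - 1)
          = smg_epoch n f \<beta> \<eta> (\<lambda>s\<in>{1..T}. \<pi> s \<omega>) (W0 \<omega>) (t - 1)"
        using t by (intro smg_epoch_cong) auto
      then show "e t \<omega> = h (W0 \<omega>, \<lambda>s\<in>{1..T}. \<pi> s \<omega>)"
        by (simp add: e_def h_def smg_iterate_def)
    qed
    show ?thesis
      using integrable_indep_selection[OF \<tau>_indep h, of t]
        expectation_indep_selection[OF \<tau>_indep h, of t] e_int[OF t] \<tau>_prob[OF t]
      by (simp add: eh H_def)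
  qed

  \<comment> \<open>exactly one summand survives, the one of the selected epoch\<close>
  have output_gap: "F (what \<omega>) - F wstar = (\<Sum>t=1..T. e t \<omega> * indicator {t} (\<tau> \<omega>))"
    if "\<omega> \<in> space M" for \<omega>
  proof -
    have "(\<Sum>t=1..T. e t \<omega> * indicator {t} (\<tau> \<omega>)) = (\<Sum>t=1..T. if t = \<tau> \<omega> then e t \<omega> else 0)"
      by (intro sum.cong) (auto simp: indicator_def)
    also have "\<dots> = e (\<tau> \<omega>) \<omega>" using \<tau>_range[OF that] by simp
    finally show ?thesis by (simp add: gap_eq e_def what[OF that])
  qed
  have "integrable M (\<lambda>\<omega>. \<Sum>t=1..T. e t \<omega> * indicator {t} (\<tau> \<omega>))"
    using selected by (intro Bochner_Integration.integrable_sum) auto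
  then have int: "integrable M (\<lambda>\<omega>. F (what \<omega>) - F wstar)"
    by (simp cong: Bochner_Integration.integrable_cong add: output_gap)
  have "expectation (\<lambda>\<omega>. F (what \<omega>) - F wstar)
      = expectation (\<lambda>\<omega>. \<Sum>t=1..T. e t \<omega> * indicator {t} (\<tau> \<omega>))"
    by (rule Bochner_Integration.integral_cong) (auto simp: output_gap)
  also have "\<dots> = (\<Sum>t=1..T. expectation (e t) * (\<eta> t / H))"
    using selected by (subst Bochner_Integration.integral_sum) auto
  also have "\<dots> = (\<Sum>t=1..T. \<eta> t * expectation (e t)) / H"
    by (simp add: sum_divide_distrib mult.commute)
  also have "\<dots> \<le> (expectation D + 4 * K * L * (Q * (\<sigma>\<^sup>2 / (3 * n)))) / (2 * (1 - \<beta>)) / H"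
  proof (rule divide_right_mono)
    show "(\<Sum>t=1..T. \<eta> t * expectation (e t))
        \<le> (expectation D + 4 * K * L * (Q * (\<sigma>\<^sup>2 / (3 * n)))) / (2 * (1 - \<beta>))"
      using averaged \<open>\<beta> < 1\<close> by (simp add: pos_le_divide_eq mult.commute)
    show "0 \<le> H" unfolding H_def using eta_pos by (intro sum_nonneg) (auto simp: less_imp_le)
  qed
  also have "\<dots> = expectation D / (2 * (1 - \<beta>) * H)
      + (4 * L * \<sigma>\<^sup>2 * (1 + \<alpha> * \<beta>)) / (6 * real n * (1 - \<beta>)) * (Q / H)"
    by (simp add: K add_divide_distrib mult_ac)
  finally show ?thesis using int by (simp add: D_def[abs_def] H_def Q_def)
qed

end
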